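(* Let $p,q,r$ be distinct primes and $G$ a finite abelian group of order $pqr$. Then there exists no (nontrivial) $(pqr,m,k,\lambda)$-SEDF in $G$ with $m>2$.
   Context: A $(v,m,k,\lambda)$-SEDF (strong external difference family) in a finite abelian group $G$ of order $v$ (written multiplicatively) is a collection $\{D_1,\dots,D_m\}$ of mutually disjoint $k$-subsets of $G$ such that for each $1\le j\le m$ and each non-identity $g\in G$, the number of pairs $(x,y)$ with $x\in D_j$, $y\in\bigcup_{i\ne j}D_i$, $xy^{-1}=g$ equals $\lambda$ (with $\lambda\ge1$). Nontrivial means $k>1$. *)

theory Defs
  imports "HOL-Algebra.Group" "HOL-Computational_Algebra.Primes" "HOL-Library.Disjoint_Sets"
begin

definition is_SEDF ::
  "('a, 'b) monoid_scheme \<Rightarrow> nat \<Rightarrow> nat \<Rightarrow> nat \<Rightarrow> nat \<Rightarrow> (nat \<Rightarrow> 'a set) \<Rightarrow> bool" where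
  "is_SEDF G v m k l D \<longleftrightarrow>
     comm_group G \<and> finite (carrier G) \<and> card (carrier G) = v \<and>
     (\<forall>i\<in>{1..m}. D i \<subseteq> carrier G \<and> card (D i) = k) \<and>
     disjoint_family_on D {1..m} \<and>
     l \<ge> 1 \<and>
     (\<forall>j\<in>{1..m}. \<forall>g\<in>carrier G - {\<one>\<^bsub>G\<^esub>}.
        card {(x, y). x \<in> D j \<and> y \<in> (\<Union>i\<in>{1..m} - {j}. D i) \<and> x \<otimes>\<^bsub>G\<^esub> inv\<^bsub>G\<^esub> y = g} = l)"

(* The trivial families are those with k = 1. *)
definition nontrivial_SEDF ::
  "('a, 'b) monoid_scheme \<Rightarrow> nat \<Rightarrow> nat \<Rightarrow> nat \<Rightarrow> nat \<Rightarrow> (nat \<Rightarrow> 'a set) \<Rightarrow> bool" where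
  "nontrivial_SEDF G v m k l D \<longleftrightarrow> is_SEDF G v m k l D \<and> k > 1"

end

theory Submission
  imports Defs "Jordan_Normal_Form.Char_Poly" "HOL-Algebra.Sylow" "HOL-Algebra.Multiplicative_Group"
    "HOL-Number_Theory.Cong"
begin

text \<open>
  For a nonprincipal character \<open>\<chi>\<close>, put \<open>z\<^sub>j = \<chi>(D\<^sub>j)\<close> and let \<open>S\<close> be the sum of the \<open>z\<^sub>j\<close>.
  The defining property gives \<open>z\<^sub>j \<cdot> cnj S - |z\<^sub>j|\<^sup>2 = -\<lambda>\<close>. If \<open>S = 0\<close>, all \<open>|z\<^sub>j|\<^sup>2\<close> equal \<open>\<lambda>\<close>.
  Otherwise the \<open>z\<^sub>j\<close> take two values \<open>u y\<close> and \<open>- w y\<close> with coprime \<open>u > w\<close>, where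
  \<open>\<lambda> = u w |y|\<^sup>2\<close> and \<open>u + w\<close> divides \<open>m - 2\<close>.

  The Frobenius congruence \<open>\<chi>(X)^q \<equiv> \<chi>^q(X)\<close> modulo \<open>q\<close>, in the ring generated by a root of unity,
  compares characters whose orders differ by a prime factor \<open>q\<close>. Comparison of prime order with the
  trivial character shows that every prime factor of \<open>v\<close> not dividing \<open>k\<close> divides \<open>m\<close> (if \<open>S = 0\<close>)
  or \<open>u + w\<close> and hence \<open>m - 2\<close>. Sizes (\<open>m k < v\<close>, \<open>\<lambda> < k\<close>) then exclude most distributions of the
  three primes. If exactly one prime divides \<open>k\<close>, the parameter equation becomes a negative Pell
  equation \<open>x^2 + 1 = p (p + 1) y^2\<close>, which is unsolvable by descent. If \<open>q\<close> divides \<open>m\<close> and the other two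
  primes divide \<open>m - 2\<close>, take \<open>r \<noteq> 2\<close> among the latter: a character of order \<open>q r\<close> and its \<open>q\<close>-th
  power split the \<open>D\<^sub>j\<close> into the same two classes, so \<open>u / w\<close> is the same for both, although it
  is \<open>1\<close> modulo \<open>r\<close> for the first and \<open>-1\<close> for the second.
\<close>

section \<open>The ring generated by a root of unity\<close>

text \<open>The ring Z[zeta] with zeta = exp(2 pi i / n); for \<open>n = 0\<close> division by zero
  gives zeta = 1 and the ring Z.\<close>

definition cyclotomic :: "nat \<Rightarrow> complex set" where
  "cyclotomic n = range (\<lambda>f :: int poly. poly (map_poly of_int f) (cis (2 * pi / n)))"

lemma cyclotomicI: "x = poly (map_poly of_int f) (cis (2 * pi / n)) \<Longrightarrow> x \<in> cyclotomic n"
  by (auto simp: cyclotomic_def)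

lemma cyclotomicE:
  assumes "x \<in> cyclotomic n"
  obtains f :: "int poly" where "x = poly (map_poly of_int f) (cis (2 * pi / n))"
  using assms by (auto simp: cyclotomic_def)

lemma cyclotomic_add: "x \<in> cyclotomic n \<Longrightarrow> y \<in> cyclotomic n \<Longrightarrow> x + y \<in> cyclotomic n"
  by (elim cyclotomicE, rule cyclotomicI[of _ "_ + _"]) (simp add: of_int_poly_hom.hom_add)

lemma cyclotomic_mult: "x \<in> cyclotomic n \<Longrightarrow> y \<in> cyclotomic n \<Longrightarrow> x * y \<in> cyclotomic n"
  by (elim cyclotomicE, rule cyclotomicI[of _ "_ * _"]) (simp add: of_int_poly_hom.hom_mult)

lemma cyclotomic_of_int: "of_int k \<in> cyclotomic n"
  by (rule cyclotomicI[of _ "[:k:]"]) (simp add: poly_altdef)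

lemma cyclotomic_of_nat: "of_nat k \<in> cyclotomic n"
  using cyclotomic_of_int[of "int k"] by simp

lemma cyclotomic_0: "0 \<in> cyclotomic n" and cyclotomic_1: "1 \<in> cyclotomic n"
  using cyclotomic_of_int[of 0] cyclotomic_of_int[of 1] by simp_all

lemma cyclotomic_minus: "x \<in> cyclotomic n \<Longrightarrow> - x \<in> cyclotomic n"
  using cyclotomic_mult[OF cyclotomic_of_int[of "-1"]] by simp

lemma cyclotomic_diff: "x \<in> cyclotomic n \<Longrightarrow> y \<in> cyclotomic n \<Longrightarrow> x - y \<in> cyclotomic n"
  using cyclotomic_add[OF _ cyclotomic_minus] by fastforce

lemma cyclotomic_power: "x \<in> cyclotomic n \<Longrightarrow> x ^ k \<in> cyclotomic n"
  by (induction k) (auto intro: cyclotomic_1 cyclotomic_mult)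

lemma cyclotomic_sum: "(\<And>i. i \<in> A \<Longrightarrow> f i \<in> cyclotomic n) \<Longrightarrow> sum f A \<in> cyclotomic n"
  by (induction A rule: infinite_finite_induct) (auto intro: cyclotomic_0 cyclotomic_add)

lemma cis_in_cyclotomic: "cis (2 * pi / n) \<in> cyclotomic n"
  by (rule cyclotomicI[of _ "[:0, 1:]"]) simp

lemma cis_root_power: "n > 0 \<Longrightarrow> cis (2 * pi / n) ^ n = 1"
  by (simp add: DeMoivre)

lemma cyclotomic_cnj:
  assumes n: "n > 0" and x: "x \<in> cyclotomic n"
  shows "cnj x \<in> cyclotomic n"
proof -
  let ?z = "cis (2 * pi / n)"
  obtain f :: "int poly" where f: "x = poly (map_poly of_int f) ?z"
    using x by (rule cyclotomicE)
  \<comment> \<open>Conjugation inverts the root, and its inverse is one of its powers.\<close>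
  have "?z * ?z ^ (n - 1) = 1"
    using cis_root_power[OF n] n by (metis power_Suc Suc_pred' gr0_implies_Suc diff_Suc_1)
  moreover have "?z * cnj ?z = 1"
    by (simp add: cis_cnj cis_mult)
  ultimately have z: "cnj ?z = ?z ^ (n - 1)"
    by (metis mult_left_cancel zero_neq_one mult_zero_left)
  have "cnj x = (\<Sum>i\<le>degree f. of_int (poly.coeff f i) * (?z ^ (n - 1)) ^ i)"
    unfolding f poly_altdef z[symmetric] by simp
  also have "\<dots> \<in> cyclotomic n"
    by (intro cyclotomic_sum cyclotomic_mult cyclotomic_of_int cyclotomic_power cis_in_cyclotomic)
  finally show ?thesis .
qed

lemma root_mod:
  fixes z :: "'a :: monoid_mult"
  assumes "z ^ n = 1"
  shows "z ^ (k mod n) = z ^ k"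
  by (metis assms div_mult_mod_eq mult.commute mult_1 power_add power_mult power_one)

text \<open>Multiplication by an element of the ring acts on the powers of the root of unity
  as an integer matrix, which has that element as an eigenvalue.\<close>
lemma cyclotomic_algebraic_int:
  assumes n: "n > 0" and x: "x \<in> cyclotomic n"
  shows "algebraic_int x"
proof -
  let ?z = "cis (2 * pi / n)"
  obtain f :: "int poly" where f: "x = poly (map_poly of_int f) ?z"
    using x by (rule cyclotomicE)
  define M where "M = mat n n (\<lambda>(i, j). \<Sum>k | k \<le> degree f \<and> (k + i) mod n = j. poly.coeff f k)"
  define v where "v = vec n (\<lambda>i. ?z ^ i)"
  let ?M = "map_mat complex_of_int M"
  have M: "M \<in> carrier_mat n n" and M': "?M \<in> carrier_mat n n"
    by (auto simp: M_def)
  have "?M *\<^sub>v v = x \<cdot>\<^sub>v v"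
  proof (rule eq_vecI)
    fix i assume "i < dim_vec (x \<cdot>\<^sub>v v)"
    then have i: "i < n" by (simp add: v_def)
    have "(?M *\<^sub>v v) $ i =
        (\<Sum>j<n. (\<Sum>k | k \<le> degree f \<and> (k + i) mod n = j. of_int (poly.coeff f k)) * ?z ^ j)"
      using i by (simp add: M_def v_def scalar_prod_def atLeast0LessThan)
    also have "\<dots> = (\<Sum>j<n. \<Sum>k | k \<in> {..degree f} \<and> (k + i) mod n = j.
        of_int (poly.coeff f k) * ?z ^ ((k + i) mod n))"
      by (intro sum.cong refl) (simp add: sum_distrib_right)
    also have "\<dots> = (\<Sum>k\<le>degree f. of_int (poly.coeff f k) * ?z ^ ((k + i) mod n))"
      by (rule sum.group) (use n in auto)
    also have "\<dots> = x * ?z ^ i"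
      unfolding f root_mod[OF cis_root_power[OF n]]
      by (simp add: poly_altdef sum_distrib_left sum_distrib_right power_add mult_ac)
    finally show "(?M *\<^sub>v v) $ i = (x \<cdot>\<^sub>v v) $ i"
      using i by (simp add: v_def)
  qed (simp add: M_def v_def)
  \<comment> \<open>Entry 0 of \<open>v\<close> is \<open>?z ^ 0 = 1\<close>, so \<open>v\<close> is
    nonzero even where the powers of the root are linearly dependent.\<close>
  moreover have "v \<noteq> 0\<^sub>v n"
    using n by (metis v_def index_vec index_zero_vec(1) power_0 zero_neq_one)
  ultimately have "eigenvalue ?M x"
    unfolding eigenvalue_def eigenvector_def by (intro exI[of _ v]) (simp add: M_def v_def)
  then have "poly (map_poly of_int (char_poly M)) x = 0"
    by (simp only: eigenvalue_root_char_poly[OF M'] of_int_hom.char_poly_hom[OF M])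
  moreover have "lead_coeff (char_poly M) = 1"
    using degree_monic_char_poly[OF M] by simp
  ultimately show ?thesis
    unfolding algebraic_int_altdef_ipoly by auto
qed

text \<open>Z[zeta] meets Q only in Z; every passage from the ring back to integers rests on
  this.\<close>

lemma cyclotomic_rational_int:
  assumes "n > 0" "x \<in> cyclotomic n" "x \<in> \<rat>"
  shows "x \<in> \<int>"
  using rational_algebraic_int_is_int[OF cyclotomic_algebraic_int[OF assms(1,2)] assms(3)] .

lemma root_of_unity_in_cyclotomic:
  assumes n: "n > 0" and z: "z ^ n = 1"
  shows "z \<in> cyclotomic n"
proof -
  have "z \<in> {z. z ^ n = 1}" using z by simp
  then obtain k where "z = cis (2 * pi * real k / n)"
    using bij_betw_imp_surj_on[OF bij_betw_roots_unity[OF n]] by auto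
  then have "z = cis (2 * pi / n) ^ k"
    by (simp add: DeMoivre mult_ac)
  then show ?thesis
    by (simp add: cyclotomic_power cis_in_cyclotomic)
qed

section \<open>Congruences in the ring and the Frobenius map\<close>

text \<open>The modulus is the ideal generated by \<open>q\<close>, not a prime ideal above it: this
  ideal is stable under conjugation, so congruences pass to squared absolute values.\<close>

definition cyclotomic_cong :: "nat \<Rightarrow> nat \<Rightarrow> complex \<Rightarrow> complex \<Rightarrow> bool" where
  "cyclotomic_cong n q x y \<longleftrightarrow> (\<exists>c\<in>cyclotomic n. x - y = of_nat q * c)"

lemma cyclotomic_cong_refl: "cyclotomic_cong n q x x"
  unfolding cyclotomic_cong_def using cyclotomic_0 by force

lemma cyclotomic_cong_add:
  assumes "cyclotomic_cong n q x y" "cyclotomic_cong n q x' y'"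
  shows "cyclotomic_cong n q (x + x') (y + y')"
proof -
  obtain c c' where "c \<in> cyclotomic n" "x - y = of_nat q * c"
      "c' \<in> cyclotomic n" "x' - y' = of_nat q * c'"
    using assms by (auto simp: cyclotomic_cong_def)
  then show ?thesis
    unfolding cyclotomic_cong_def
    by (intro bexI[of _ "c + c'"] cyclotomic_add) (simp_all add: algebra_simps)
qed

lemma cyclotomic_cong_diff:
  assumes "cyclotomic_cong n q x y" "cyclotomic_cong n q x' y'"
  shows "cyclotomic_cong n q (x - x') (y - y')"
proof -
  obtain c c' where "c \<in> cyclotomic n" "x - y = of_nat q * c"
      "c' \<in> cyclotomic n" "x' - y' = of_nat q * c'"
    using assms by (auto simp: cyclotomic_cong_def)
  then show ?thesis
    unfolding cyclotomic_cong_def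
    by (intro bexI[of _ "c - c'"] cyclotomic_diff) (simp_all add: algebra_simps)
qed

lemma cyclotomic_cong_mult:
  assumes "cyclotomic_cong n q x y" "cyclotomic_cong n q x' y'"
    and "x' \<in> cyclotomic n" "y \<in> cyclotomic n"
  shows "cyclotomic_cong n q (x * x') (y * y')"
proof -
  obtain c c' where c: "c \<in> cyclotomic n" "x - y = of_nat q * c"
      "c' \<in> cyclotomic n" "x' - y' = of_nat q * c'"
    using assms by (auto simp: cyclotomic_cong_def)
  have "x * x' - y * y' = (x - y) * x' + y * (x' - y')"
    by (simp add: algebra_simps)
  also have "\<dots> = of_nat q * (c * x' + y * c')"
    unfolding c by (simp add: algebra_simps)
  finally show ?thesis
    unfolding cyclotomic_cong_def using c assms(3,4)
    by (intro bexI[of _ "c * x' + y * c'"] cyclotomic_add cyclotomic_mult)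
qed

lemma cyclotomic_cong_trans:
  "cyclotomic_cong n q x y \<Longrightarrow> cyclotomic_cong n q y z \<Longrightarrow> cyclotomic_cong n q x z"
  using cyclotomic_cong_add[of n q x y y z]
  by (auto simp: cyclotomic_cong_def)

lemma cyclotomic_cong_cnj:
  assumes "n > 0" "cyclotomic_cong n q x y"
  shows "cyclotomic_cong n q (cnj x) (cnj y)"
proof -
  obtain c where "c \<in> cyclotomic n" "x - y = of_nat q * c"
    using assms by (auto simp: cyclotomic_cong_def)
  then have "cnj c \<in> cyclotomic n" "cnj x - cnj y = of_nat q * cnj c"
    using assms(1) by (auto intro: cyclotomic_cnj simp flip: complex_cnj_diff)
  then show ?thesis
    by (auto simp: cyclotomic_cong_def)
qed

lemma cyclotomic_cong_of_int:
  assumes n: "n > 0" and q: "q > 0" and "cyclotomic_cong n q (of_int a) (of_int b)"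
  shows "[a = b] (mod int q)"
proof -
  obtain c where c: "c \<in> cyclotomic n" "of_int a - of_int b = of_nat q * c"
    using assms by (auto simp: cyclotomic_cong_def)
  then have "c = of_int (a - b) / of_int (int q)"
    using q by (simp add: field_simps)
  also have "\<dots> \<in> \<rat>" by (intro Rats_divide Rats_of_int)
  finally have "c \<in> \<int>" using cyclotomic_rational_int[OF n c(1)] by blast
  then obtain d where "c = of_int d" by (elim Ints_cases)
  then have "complex_of_int (a - b) = of_int (int q * d)"
    using c by simp
  then have "a - b = int q * d" by (simp only: of_int_eq_iff)
  then show ?thesis
    by (auto simp: cong_iff_dvd_diff)
qed

lemma cyclotomic_freshman:
  assumes q: "Factorial_Ring.prime q" and x: "x \<in> cyclotomic n" and y: "y \<in> cyclotomic n"
  shows "cyclotomic_cong n q ((x + y) ^ q) (x ^ q + y ^ q)"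
proof -
  have q0: "q > 0" using q by (simp add: prime_gt_0_nat)
  have split: "{..q} = insert 0 (insert q {0<..<q})" by (use q0 in auto)
  \<comment> \<open>The binomial sum without its end terms, divided by \<open>q\<close>; the
    division is exact because the prime \<open>q\<close> divides the inner binomial
    coefficients.\<close>
  define c where "c = (\<Sum>k\<in>{0<..<q}. of_nat ((q choose k) div q) * x ^ k * y ^ (q - k))"
  have "(x + y) ^ q = x ^ q + y ^ q + (\<Sum>k\<in>{0<..<q}. of_nat (q choose k) * x ^ k * y ^ (q - k))"
    unfolding binomial_ring split using q0 by (simp add: add_ac)
  also have "(\<Sum>k\<in>{0<..<q}. of_nat (q choose k) * x ^ k * y ^ (q - k)) = of_nat q * c"
    unfolding c_def sum_distrib_left
  proof (intro sum.cong refl)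
    fix k assume "k \<in> {0<..<q}"
    then have "q dvd (q choose k)"
      by (intro dvd_choose_prime) (use q in auto)
    then have "(q choose k) = q * ((q choose k) div q)" by simp
    then have "complex_of_nat (q choose k) = of_nat q * of_nat ((q choose k) div q)"
      by (metis of_nat_mult)
    then show "of_nat (q choose k) * x ^ k * y ^ (q - k) =
        of_nat q * (of_nat ((q choose k) div q) * x ^ k * y ^ (q - k))"
      by (simp add: mult_ac)
  qed
  finally have "(x + y) ^ q - (x ^ q + y ^ q) = of_nat q * c" by simp
  moreover have "c \<in> cyclotomic n"
    unfolding c_def
    by (intro cyclotomic_sum cyclotomic_mult cyclotomic_of_nat cyclotomic_power x y)
  ultimately show ?thesis
    unfolding cyclotomic_cong_def by blast
qed

lemma cyclotomic_frobenius_sum: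
  assumes q: "Factorial_Ring.prime q" and "finite A" "\<And>i. i \<in> A \<Longrightarrow> f i \<in> cyclotomic n"
  shows "cyclotomic_cong n q ((\<Sum>i\<in>A. f i) ^ q) (\<Sum>i\<in>A. f i ^ q)"
  using assms(2,3)
proof (induction A rule: finite_induct)
  case empty
  then show ?case
    using q by (simp add: prime_gt_0_nat power_0_left cyclotomic_cong_refl)
next
  case (insert a A)
  have "cyclotomic_cong n q ((f a + sum f A) ^ q) (f a ^ q + sum f A ^ q)"
    by (intro cyclotomic_freshman[OF q] cyclotomic_sum) (use insert in auto)
  moreover have "cyclotomic_cong n q (f a ^ q + sum f A ^ q) (f a ^ q + (\<Sum>i\<in>A. f i ^ q))"
    by (intro cyclotomic_cong_add cyclotomic_cong_refl) (use insert in auto)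
  ultimately show ?case
    using insert by (auto intro: cyclotomic_cong_trans)
qed

text \<open>The additive rule is applied to \<open>x = (x - y) + y\<close>; expanding
  \<open>(x + (- y)) ^ q\<close> would bring in the sign \<open>(- 1) ^ q\<close>, which differs for
  \<open>q = 2\<close>.\<close>

lemma cyclotomic_frobenius_diff:
  assumes q: "Factorial_Ring.prime q" and x: "x \<in> cyclotomic n" and y: "y \<in> cyclotomic n"
    and x': "cyclotomic_cong n q (x ^ q) x'" and y': "cyclotomic_cong n q (y ^ q) y'"
  shows "cyclotomic_cong n q ((x - y) ^ q) (x' - y')"
proof -
  have "cyclotomic_cong n q ((x - y + y) ^ q) ((x - y) ^ q + y ^ q)"
    by (intro cyclotomic_freshman[OF q] cyclotomic_diff x y)
  then have "cyclotomic_cong n q ((x - y) ^ q + y ^ q) (x ^ q)"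
    unfolding cyclotomic_cong_def
    by (metis cyclotomic_minus diff_add_cancel minus_diff_eq mult_minus_right)
  then have "cyclotomic_cong n q ((x - y) ^ q + y ^ q) x'"
    using x' by (rule cyclotomic_cong_trans)
  from cyclotomic_cong_diff[OF this y'] show ?thesis by simp
qed

text \<open>Fermat's little theorem, read off from the Frobenius congruence for a sum of
  \<open>b\<close> ones in \<open>cyclotomic 1\<close>, which is Z.\<close>

lemma prime_power_cong_self:
  fixes a :: int
  assumes "Factorial_Ring.prime q"
  shows "[a ^ q = a] (mod int q)"
proof -
  have "[of_nat b ^ q = of_nat b] (mod int q)" for b :: nat
    using cyclotomic_frobenius_sum[OF assms, of "{..<b}" "\<lambda>_. 1" 1]
      cyclotomic_cong_of_int[of 1 q "int b ^ q" "int b"] assms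
    by (simp add: cyclotomic_1 prime_gt_0_nat)
  from this[of "nat (a mod int q)"]
  have "[(a mod int q) ^ q = a mod int q] (mod int q)"
    using assms by (simp add: prime_gt_0_nat)
  then show ?thesis
    by (simp add: cong_def power_mod)
qed

text \<open>The congruence times its conjugate compares \<open>N ^ q\<close> with \<open>N'\<close>,
  and Fermat replaces \<open>N ^ q\<close> by \<open>N\<close>. Comparing characters thereby becomes
  integer arithmetic.\<close>

lemma cyclotomic_norm_cong:
  assumes n: "n > 0" and q: "Factorial_Ring.prime q"
    and z: "z \<in> cyclotomic n" "z' \<in> cyclotomic n" "cyclotomic_cong n q (z ^ q) z'"
    and N: "z * cnj z = of_int N" and N': "z' * cnj z' = of_int N'"
  shows "[N = N'] (mod int q)"
proof -
  have "cyclotomic_cong n q (z ^ q * cnj (z ^ q)) (z' * cnj z')"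
    by (intro cyclotomic_cong_mult cyclotomic_cong_cnj n z cyclotomic_cnj cyclotomic_power)
  moreover have "z ^ q * cnj (z ^ q) = of_int (N ^ q)"
    by (simp add: N flip: power_mult_distrib)
  ultimately have "[N ^ q = N'] (mod int q)"
    unfolding N' using n q by (intro cyclotomic_cong_of_int[of n]) (auto simp: prime_gt_0_nat)
  with prime_power_cong_self[OF q, of N] show ?thesis
    using cong_sym cong_trans by blast
qed

section \<open>Arithmetic of the parameters\<close>

text \<open>The descent divides a solution by the unit \<open>(2 p + 1) + 2 \<surd>(p (p + 1))\<close>.\<close>
lemma negative_pell:
  fixes k l p :: int
  assumes "p \<ge> 2" "l \<ge> 1" "k \<ge> 0" "k ^ 2 + 1 = p * (p + 1) * l ^ 2"
  shows False
  using assms(2-)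
proof (induction "nat l" arbitrary: k l rule: less_induct)
  case less
  define k' where "k' = (2 * p + 1) * k - 2 * (p * (p + 1)) * l"
  define l' where "l' = (2 * p + 1) * l - 2 * k"
  have eq: "k ^ 2 + 1 = p ^ 2 * l ^ 2 + p * l ^ 2"
    using less.prems(3) by (simp add: algebra_simps power2_eq_square)
  have l2: "l ^ 2 \<ge> 1" using less.prems(1) by simp
  \<comment> \<open>The strict bound rests on \<open>p \<ge> 2\<close>; for \<open>p = 1\<close> the
    equation has the solution \<open>k = l = 1\<close>.\<close>
  then have "p * l ^ 2 \<ge> p * 1" using assms(1) by (intro mult_left_mono) auto
  then have "p * l ^ 2 > 1" using assms(1) by linarith
  then have "(p * l) ^ 2 < k ^ 2"
    unfolding power_mult_distrib using eq by linarith
  then have pl: "p * l < k"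
    using less.prems(2) by (rule power2_less_imp_less)
  have "(2 * k) ^ 2 < ((2 * p + 1) * l) ^ 2"
    using eq l2 by (simp add: power2_eq_square algebra_simps)
  then have "2 * k < (2 * p + 1) * l"
    by (rule power2_less_imp_less) (use assms(1) less.prems in simp)
  \<comment> \<open>The bounds \<open>p * l < k\<close> and \<open>2 * k < (2 * p + 1) * l\<close>
    say exactly \<open>l' < l\<close> and \<open>l' > 0\<close>, so the descent never stops.\<close>
  then have l': "l' \<ge> 1" "l' < l"
    using pl by (auto simp: l'_def algebra_simps)
  \<comment> \<open>The unit has norm \<open>(2 * p + 1) ^ 2 - 4 * p * (p + 1) = 1\<close>, so the
    form is preserved; the sign of \<open>k'\<close> is left open.\<close>
  have "k' ^ 2 + 1 - p * (p + 1) * l' ^ 2 = k ^ 2 + 1 - p * (p + 1) * l ^ 2"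
    unfolding k'_def l'_def by (simp add: power2_eq_square algebra_simps)
  then have "\<bar>k'\<bar> ^ 2 + 1 = p * (p + 1) * l' ^ 2"
    using less.prems(3) by simp
  moreover have "nat l' < nat l" using l' by simp
  ultimately show False
    using less.hyps[of l' "\<bar>k'\<bar>"] l' by simp
qed

text \<open>Here \<open>k\<close> and \<open>l\<close> are the parameters of the family divided by \<open>p\<close> and \<open>p\<^sup>2\<close>. The integer \<open>s\<close>
  satisfies \<open>(p q r - 1) s = k\<^sup>2 (p + a b)\<close>, and the size bounds force \<open>a b = s = 1\<close>.\<close>
lemma one_prime_parameters:
  fixes k l m p q r a b :: int
  assumes pos: "p \<ge> 2" "k \<ge> 1" "l \<ge> 1" "a \<ge> 1" "b \<ge> 1"
    and m: "m = q * a" "m - 2 = r * b"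
    and count: "k ^ 2 * (m - 1) = l * (p * q * r - 1)"
    and v: "p * q * r > 1" and kl: "p * l \<le> k"
  shows False
proof -
  define V where "V = p * q * r - 1"
  define s where "s = p * (m - 1) * l - a * b * k ^ 2"
  have V: "V > 0" using v by (simp add: V_def)
  have k2: "k ^ 2 > 0" using pos by simp
  \<comment> \<open>The product of the two factorizations expresses \<open>q * r\<close>, and hence
    \<open>V\<close>, through \<open>m\<close>, \<open>a\<close> and \<open>b\<close>.\<close>
  have "(q * a) * (r * b) = m * (m - 2)"
    using m by simp
  then have ab: "a * b * (q * r) = (m - 1) ^ 2 - 1"
    by (simp add: power2_eq_square algebra_simps)
  have "V * s = p * (m - 1) * (l * V) - a * b * k ^ 2 * V"
    by (simp add: s_def algebra_simps)
  also have "l * V = k ^ 2 * (m - 1)"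
    using count by (simp add: V_def)
  also have "a * b * k ^ 2 * V = k ^ 2 * (p * (a * b * (q * r)) - a * b)"
    by (simp add: V_def algebra_simps)
  also have "p * (m - 1) * (k ^ 2 * (m - 1)) - k ^ 2 * (p * (a * b * (q * r)) - a * b) =
      k ^ 2 * (p + a * b)"
    unfolding ab by (simp add: algebra_simps power2_eq_square)
  finally have Vs: "V * s = k ^ 2 * (p + a * b)" .
  have ab1: "a * b \<ge> 1" using pos mult_mono[of 1 a 1 b] by simp
  then have "V * s > 0" unfolding Vs using k2 pos by (intro mult_pos_pos) auto
  then have s: "s \<ge> 1" using V by (simp add: zero_less_mult_iff)
  \<comment> \<open>Positivity of \<open>s\<close>, the counting equation and
    \<open>p * l \<le> k\<close> combine to the lower bound \<open>big\<close> for
    \<open>V\<close>.\<close>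
  have "a * b * k ^ 2 * k ^ 2 < p * (m - 1) * l * k ^ 2"
    using s k2 by (intro mult_strict_right_mono) (auto simp: s_def)
  also have "\<dots> = p * l * (k ^ 2 * (m - 1))" by (simp add: mult_ac)
  also have "\<dots> = p * l ^ 2 * V" unfolding count V_def by (simp add: power2_eq_square mult_ac)
  finally have 1: "a * b * k ^ 2 * k ^ 2 < p * l ^ 2 * V" .
  have "(p * l) ^ 2 \<le> k ^ 2" using kl pos by (intro power_mono) auto
  then have "a * b * k ^ 2 * (p * l) ^ 2 \<le> a * b * k ^ 2 * k ^ 2"
    using ab1 k2 by (intro mult_left_mono) auto
  with 1 have "(p * l ^ 2) * (a * b * k ^ 2 * p) < (p * l ^ 2) * V"
    by (simp add: power2_eq_square mult_ac)
  then have big: "a * b * k ^ 2 * p < V"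
    using pos by (simp add: mult_less_cancel_left_pos)
  \<comment> \<open>With \<open>V * s = k ^ 2 * (p + a * b)\<close> and the bound \<open>big\<close>
    this leaves \<open>(a * b - 1) * (p - 1) < 1\<close>.\<close>
  have "V * 1 \<le> V * s" using s V by (intro mult_left_mono) auto
  with big Vs have "k ^ 2 * (a * b * p) < k ^ 2 * (p + a * b)"
    by (simp add: mult_ac)
  then have less: "a * b * p < p + a * b" using k2 by (simp add: mult_less_cancel_left_pos)
  have "a * b = 1"
  proof (rule ccontr)
    assume "a * b \<noteq> 1"
    then have "a * b - 1 \<ge> 1" using ab1 by simp
    then have "(a * b - 1) * (p - 1) \<ge> 1 * (p - 1)" using pos by (intro mult_right_mono) auto
    with less ab1 pos show False by (simp add: algebra_simps)
  qed
  have "s = 1"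
  proof (rule ccontr)
    assume "s \<noteq> 1"
    then have "V * 2 \<le> V * s" using s V by (intro mult_left_mono) auto
    with Vs \<open>a * b = 1\<close> have "V * 2 \<le> k ^ 2 * (p + 1)" by simp
    moreover have "k ^ 2 * p < V" using big \<open>a * b = 1\<close> by simp
    ultimately have "k ^ 2 * (2 * p) < k ^ 2 * (p + 1)" by (simp add: algebra_simps)
    then show False using pos k2 by (simp add: mult_less_cancel_left_pos)
  qed
  \<comment> \<open>The counting equation now gives \<open>m - 1 = l * (p + 1)\<close>, and the
    definition of \<open>s\<close> turns into the Pell equation.\<close>
  have VV: "V = k ^ 2 * (p + 1)" using Vs \<open>s = 1\<close> \<open>a * b = 1\<close> by simp
  have "k ^ 2 * (m - 1) = k ^ 2 * (l * (p + 1))"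
    using count unfolding V_def[symmetric] VV by (simp add: mult_ac)
  then have "m - 1 = l * (p + 1)" using k2 by simp
  then have "k ^ 2 + 1 = p * (p + 1) * l ^ 2"
    using \<open>s = 1\<close> \<open>a * b = 1\<close> by (simp add: s_def power2_eq_square mult_ac)
  then show False
    by (intro negative_pell[of p l k]) (use pos in auto)
qed

section \<open>Character values\<close>

text \<open>\<open>A\<close> is the smaller class and carries the larger coefficient. The clause
  with \<open>g\<close> makes the class sizes \<open>1 + w * g\<close> and \<open>1 + u * g\<close>,
  so the values add up to \<open>(u - w) * y\<close>.\<close>

definition two_valued ::
  "nat \<Rightarrow> (nat \<Rightarrow> complex) \<Rightarrow> nat set \<Rightarrow> nat \<Rightarrow> nat \<Rightarrow> nat \<Rightarrow> complex \<Rightarrow> bool" where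
  "two_valued m z A u w n y \<longleftrightarrow>
     A \<subseteq> {1..m} \<and> A \<noteq> {} \<and> 2 * card A < m \<and> coprime u w \<and> 1 \<le> w \<and> w < u \<and>
     (\<exists>g. (u + w) * g = m - 2 \<and> card A = 1 + w * g) \<and> y * cnj y = of_nat n \<and>
     (\<forall>i\<in>A. z i = of_nat u * y) \<and> (\<forall>i\<in>{1..m} - A. z i = - (of_nat w * y))"

text \<open>Division by \<open>S\<close> turns the equation into
  \<open>c - |c|^2 = - l / |S|^2\<close>. So each quotient \<open>c\<close> is real and a root of
  \<open>X^2 - X = l / |S|^2\<close>, with roots \<open>(1 + t) / 2\<close> and
  \<open>(1 - t) / 2\<close>.\<close>

lemma values_real_multiples:
  fixes z :: "nat \<Rightarrow> complex" and l :: real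
  assumes m: "m > 2" and l: "l > 0"
    and S: "S = (\<Sum>i\<in>{1..m}. z i)" "S \<noteq> 0"
    and eq: "\<And>i. i \<in> {1..m} \<Longrightarrow> z i * cnj S - z i * cnj (z i) = - of_real l"
  obtains t :: real and A where "A \<subseteq> {1..m}" "t > 1"
    "t * (real m - 2 * real (card A)) = real m - 2"
    "t ^ 2 = 1 + 4 * l / (cmod S)\<^sup>2"
    "\<And>i. i \<in> A \<Longrightarrow> z i = of_real ((1 + t) / 2) * S"
    "\<And>i. i \<in> {1..m} - A \<Longrightarrow> z i = of_real ((1 - t) / 2) * S"
proof -
  define n where "n = (cmod S)\<^sup>2"
  define a where "a i = Re (z i / S)" for i
  define t where "t = sqrt (1 + 4 * l / n)"
  have n: "n > 0" using S by (simp add: n_def)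
  have SS: "S * cnj S = of_real n" by (simp only: n_def complex_norm_square)
  have a: "z i = of_real (a i) * S" "a i ^ 2 - a i = l / n" if i: "i \<in> {1..m}" for i
  proof -
    define c where "c = z i / S"
    have zc: "z i = c * S" using S(2) by (simp add: c_def)
    have "c * (S * cnj S) - c * cnj c * (S * cnj S) = - of_real l"
      using eq[OF i] unfolding zc by (simp add: mult_ac)
    then have "c - c * cnj c = - of_real l / of_real n"
      unfolding SS using n by (simp add: field_simps)
    then have c: "c = of_real ((cmod c)\<^sup>2 - l / n)"
      by (simp add: complex_norm_square[symmetric] algebra_simps)
    have cr: "c = of_real (Re c)"
      by (subst (1 2) c) simp
    then show "z i = of_real (a i) * S"
      unfolding a_def by (metis c_def zc)
    have "Re c = (cmod c)\<^sup>2 - l / n" by (subst (1) c) simp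
    moreover have "(cmod c)\<^sup>2 = Re c ^ 2" by (subst (1) cr) simp
    ultimately show "a i ^ 2 - a i = l / n" by (simp add: a_def c_def)
  qed
  have t2: "t ^ 2 = 1 + 4 * l / n" using l n by (simp add: t_def)
  have t: "t > 1" using l n by (simp add: t_def)
  have dich: "a i = (1 + t) / 2 \<or> a i = (1 - t) / 2" if i: "i \<in> {1..m}" for i
  proof -
    have "(2 * a i - 1) ^ 2 = 4 * (a i ^ 2 - a i) + 1" by (simp add: power2_eq_square algebra_simps)
    also have "\<dots> = t ^ 2" using a(2)[OF i] t2 by simp
    finally have "2 * a i - 1 = t \<or> 2 * a i - 1 = - t" by (simp add: power2_eq_iff)
    then show ?thesis by (auto simp: field_simps)
  qed
  define A where "A = {i\<in>{1..m}. a i = (1 + t) / 2}"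
  have A: "A \<subseteq> {1..m}" "finite A" by (auto simp: A_def)
  have aA: "a i = (1 + t) / 2" if "i \<in> A" for i using that by (simp add: A_def)
  have aB: "a i = (1 - t) / 2" if "i \<in> {1..m} - A" for i using that dich by (auto simp: A_def)
  \<comment> \<open>The coefficients add up to 1; counting how often each root occurs relates
    \<open>t\<close> to \<open>card A\<close>.\<close>
  have "of_real (\<Sum>i\<in>{1..m}. a i) * S = S"
    unfolding of_real_sum sum_distrib_right
    by (rule trans[OF sum.cong[OF refl a(1)[symmetric]] S(1)[symmetric]])
  then have "(\<Sum>i\<in>{1..m}. a i) = 1" using S(2)
    by (metis mult_cancel_right1 of_real_eq_1_iff)
  moreover have "(\<Sum>i\<in>{1..m}. a i) = (\<Sum>i\<in>{1..m} - A. a i) + (\<Sum>i\<in>A. a i)"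
    using A by (intro sum.subset_diff) auto
  moreover have "(\<Sum>i\<in>A. a i) = card A * ((1 + t) / 2)" by (simp add: aA)
  moreover have "(\<Sum>i\<in>{1..m} - A. a i) = (real m - card A) * ((1 - t) / 2)"
    using A card_mono[OF _ A(1)] by (simp add: aB card_Diff_subset of_nat_diff)
  ultimately have "(real m - card A) * ((1 - t) / 2) + card A * ((1 + t) / 2) = 1" by simp
  then have "t * (real m - 2 * real (card A)) = real m - 2" by (simp add: field_simps)
  moreover have "z i = of_real ((1 + t) / 2) * S" if "i \<in> A" for i
    using a(1)[of i] aA[OF that] that A(1) by auto
  moreover have "z i = of_real ((1 - t) / 2) * S" if "i \<in> {1..m} - A" for i
    using a(1)[of i] aB[OF that] that by auto
  ultimately show thesis
    using that[of A t] A(1) t t2 unfolding n_def by blast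
qed

lemma character_values_cases:
  fixes z :: "nat \<Rightarrow> complex" and l m :: nat
  assumes m: "m > 2" and l: "l \<ge> 1" and N: "N > 0"
    and z: "\<And>i. i \<in> {1..m} \<Longrightarrow> z i \<in> cyclotomic N"
    and eq: "\<And>i. i \<in> {1..m} \<Longrightarrow> z i * cnj (\<Sum>i\<in>{1..m}. z i) - z i * cnj (z i) = - of_nat l"
  obtains (zero) "(\<Sum>i\<in>{1..m}. z i) = 0" "\<And>i. i \<in> {1..m} \<Longrightarrow> z i * cnj (z i) = of_nat l"
  | (two) A u w n y where "two_valued m z A u w n y" "l = u * w * n"
proof (cases "(\<Sum>i\<in>{1..m}. z i) = 0")
  case True
  show thesis
  proof (rule zero)
    fix i assume "i \<in> {1..m}"
    from eq[OF this] show "z i * cnj (z i) = of_nat l" unfolding True by simp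
  qed (fact True)
next
  case False
  define S where "S = (\<Sum>i\<in>{1..m}. z i)"
  obtain t :: real and A where A: "A \<subseteq> {1..m}"
    and t: "t > 1" "t * (real m - 2 * real (card A)) = real m - 2"
    "t ^ 2 = 1 + 4 * real l / (cmod S)\<^sup>2"
    and zA: "\<And>i. i \<in> A \<Longrightarrow> z i = of_real ((1 + t) / 2) * S"
    and zB: "\<And>i. i \<in> {1..m} - A \<Longrightarrow> z i = of_real ((1 - t) / 2) * S"
  proof (rule values_real_multiples[OF m _ S_def, of "real l"])
    show "real l > 0" using l by simp
    show "S \<noteq> 0" using False by (simp add: S_def)
    show "z i * cnj S - z i * cnj (z i) = - of_real (real l)" if "i \<in> {1..m}" for i
      using eq[OF that] by (simp add: S_def)
  qed blast
  define b where "b = card A"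
  define d where "d = real m - 2 * real b"
  have td: "t * d = real m - 2" using t(2) by (simp add: b_def d_def)
  have "t * d > 0" using td m by simp
  then have d: "d > 0" using t(1) by (simp add: zero_less_mult_iff)
  then have bm: "2 * b < m" by (simp add: d_def)
  have "1 * d < t * d" using t(1) d by (intro mult_strict_right_mono) auto
  then have b: "b \<ge> 2" using td by (simp add: d_def)
  \<comment> \<open>\<open>t\<close> is the quotient of the sum and the difference of
    \<open>m - 1 - b\<close> and \<open>b - 1\<close>; removing their gcd gives the coprime pair
    \<open>u\<close>, \<open>w\<close>.\<close>
  define g where "g = gcd (m - 1 - b) (b - 1)"
  have g: "g > 0" using b by (simp add: g_def)
  obtain u w where uw: "m - 1 - b = u * g" "b - 1 = w * g" "coprime u w"
    using gcd_coprime_exists[of "m - 1 - b" "b - 1"] g unfolding g_def by auto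
  have w: "w \<ge> 1" using uw(2) b by (cases w) auto
  have "w * g < u * g" unfolding uw(1,2)[symmetric] using bm b by linarith
  then have wu: "w < u" by simp
  have sum: "(u + w) * g = m - 2" using uw(1,2) bm b by (simp add: algebra_simps)
  have bw: "b = 1 + w * g" using uw(2) b by simp
  have du: "d = (real u - real w) * g"
  proof -
    have "real m = real ((u + w) * g) + 2" using sum m by simp
    then show ?thesis by (simp add: d_def bw algebra_simps)
  qed
  have "t * ((real u - real w) * g) = (real u + real w) * g"
    using td sum m unfolding du by (metis of_nat_add of_nat_diff of_nat_mult of_nat_numeral less_imp_le)
  then have "(t * (real u - real w)) * g = (real u + real w) * g"
    by (simp only: mult.assoc)
  then have "t * (real u - real w) = real u + real w"
    using g by simp
  then have tu: "t = (real u + real w) / (real u - real w)"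
    using wu by (simp add: field_simps)
  \<comment> \<open>The coefficients are \<open>u / (u - w)\<close> and
    \<open>- w / (u - w)\<close>; this scaling of \<open>S\<close> clears the denominator.\<close>
  define y where "y = S / of_real (real u - real w)"
  have uw0: "real u - real w \<noteq> 0" using wu by simp
  have Sy: "S = of_real (real u - real w) * y" using uw0 by (simp add: y_def)
  have zA': "z i = of_nat u * y" if "i \<in> A" for i
  proof -
    have "(1 + t) / 2 = real u / (real u - real w)" unfolding tu using uw0 by (simp add: field_simps)
    then have "(1 + t) / 2 * (real u - real w) = real u" by (simp only: nonzero_eq_divide_eq[OF uw0])
    then show ?thesis using zA[OF that] unfolding Sy
      by (metis mult.assoc of_real_mult of_real_of_nat_eq)
  qed
  have zB': "z i = - (of_nat w * y)" if "i \<in> {1..m} - A" for i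
  proof -
    have "(1 - t) / 2 = - real w / (real u - real w)" unfolding tu using uw0 by (simp add: field_simps)
    then have "(1 - t) / 2 * (real u - real w) = - real w" by (simp only: nonzero_eq_divide_eq[OF uw0])
    then show ?thesis using zB[OF that] unfolding Sy
      by (metis mult.assoc of_real_mult of_real_of_nat_eq of_real_minus mult_minus_left)
  qed
  have S0: "(cmod S)\<^sup>2 > 0" using False by (simp add: S_def)
  define x where "x = (cmod y)\<^sup>2"
  have Sx: "(cmod S)\<^sup>2 = (real u - real w)\<^sup>2 * x"
    unfolding Sy x_def norm_mult power_mult_distrib by (simp only: norm_of_real power2_abs)
  have "t ^ 2 - 1 = 4 * real u * real w / (real u - real w)\<^sup>2"
  proof -
    have "t ^ 2 - 1 = ((real u + real w)\<^sup>2 - (real u - real w)\<^sup>2) / (real u - real w)\<^sup>2"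
      unfolding tu power_divide using uw0 by (simp only: diff_divide_distrib) simp
    also have "(real u + real w)\<^sup>2 - (real u - real w)\<^sup>2 = 4 * real u * real w"
      by (simp add: power2_eq_square algebra_simps)
    finally show ?thesis .
  qed
  then have "4 * real u * real w / (real u - real w)\<^sup>2 = 4 * real l / ((real u - real w)\<^sup>2 * x)"
    using t(3) Sx by simp
  moreover have "x > 0" using S0 Sx uw0 by (simp add: zero_less_mult_iff)
  ultimately have lx: "real l = real u * real w * x" using uw0 by (simp add: field_simps)
  have yy: "y * cnj y = of_real x" by (simp only: x_def complex_norm_square)
  have card_A: "card A \<noteq> 0" "card A < card {1..m}" using b bm by (auto simp: b_def)
  have A0: "A \<noteq> {}" and B0: "{1..m} - A \<noteq> {}"
    using card_A A by auto
  have int: "e ^ 2 * x \<in> \<int>" if i: "i \<in> {1..m}" and e: "z i * cnj (z i) = of_real (e ^ 2 * x)"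
    and eq': "e ^ 2 * x \<in> \<rat>" for e :: real and i
  proof -
    have "complex_of_real (e ^ 2 * x) \<in> cyclotomic N"
      unfolding e[symmetric] by (intro cyclotomic_mult cyclotomic_cnj z i N)
    moreover have "complex_of_real (e ^ 2 * x) \<in> \<rat>"
    proof -
      obtain a b where "e ^ 2 * x = of_int a / of_int b"
        using eq' unfolding Rats_eq_int_div_int by blast
      then have "complex_of_real (e ^ 2 * x) = of_int a / of_int b" by simp
      then show ?thesis by (simp only: Rats_divide Rats_of_int)
    qed
    ultimately have "complex_of_real (e ^ 2 * x) \<in> \<int>"
      by (intro cyclotomic_rational_int[OF N])
    then show ?thesis by (metis Ints_cases Ints_of_int of_real_eq_iff of_real_of_int_eq)
  qed
  \<comment> \<open>The squared absolute values \<open>u ^ 2 * x = l * u / w\<close> and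
    \<open>w ^ 2 * x = l * w / u\<close> are integers. By coprimality \<open>w\<close> and
    \<open>u\<close> divide \<open>l\<close>, so \<open>x = l / (u * w)\<close> is an integer
    too.\<close>
  have "w dvd l"
  proof -
    obtain i where i: "i \<in> A" using A0 by blast
    have "real u ^ 2 * x = real l * real u / real w" using lx w by (simp add: field_simps power2_eq_square)
    moreover have "\<dots> \<in> \<rat>" by (intro Rats_divide Rats_mult Rats_of_nat)
    moreover have "z i * cnj (z i) = of_real (real u ^ 2 * x)"
      unfolding zA'[OF i] using yy by (simp add: power2_eq_square mult_ac)
    ultimately have "real u ^ 2 * x \<in> \<int>" using int[of i "real u"] i A by auto
    then obtain c where "real u ^ 2 * x = of_int c" by (elim Ints_cases)
    then have "real l * real u = of_int c * real w" using \<open>_ = real l * real u / real w\<close> w by (simp add: field_simps)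
    then have "int l * int u = c * int w" by (metis of_int_eq_iff of_int_mult of_int_of_nat_eq)
    then have "int w dvd int (l * u)" by simp
    then have "w dvd l * u" by (simp only: int_dvd_int_iff)
    then show ?thesis using uw(3) by (simp add: coprime_commute coprime_dvd_mult_left_iff)
  qed
  moreover have "u dvd l"
  proof -
    obtain i where i: "i \<in> {1..m} - A" using B0 by blast
    have "real w ^ 2 * x = real l * real w / real u" using lx wu by (simp add: field_simps power2_eq_square)
    moreover have "\<dots> \<in> \<rat>" by (intro Rats_divide Rats_mult Rats_of_nat)
    moreover have "z i * cnj (z i) = of_real (real w ^ 2 * x)"
      unfolding zB'[OF i] using yy by (simp add: power2_eq_square mult_ac)
    ultimately have "real w ^ 2 * x \<in> \<int>" using int[of i "real w"] i A by auto
    then obtain c where "real w ^ 2 * x = of_int c" by (elim Ints_cases)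
    then have "real l * real w = of_int c * real u" using \<open>_ = real l * real w / real u\<close> wu by (simp add: field_simps)
    then have "int l * int w = c * int u" by (metis of_int_eq_iff of_int_mult of_int_of_nat_eq)
    then have "int u dvd int (l * w)" by simp
    then have "u dvd l * w" by (simp only: int_dvd_int_iff)
    then show ?thesis using uw(3) by (simp add: coprime_dvd_mult_left_iff)
  qed
  ultimately have "u * w dvd l" using uw(3) by (simp add: divides_mult)
  then obtain n where n: "l = u * w * n" by (elim dvdE)
  then have "x = real n" using lx w wu by simp
  then have "y * cnj y = of_nat n" using yy by simp
  then have "two_valued m z A u w n y"
    unfolding two_valued_def using A A0 bm uw(3) w wu sum bw zA' zB' by (auto simp: b_def)
  then show thesis using n by (rule two)
qed

section \<open>Characters of finite abelian groups\<close>

text \<open>\<open>n\<close> is a common exponent, not the exact order of \<open>\<chi>\<close>: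
  powers of a character keep the same \<open>n\<close>, so all values to be compared lie in one
  ring.\<close>

definition character :: "('a, 'b) monoid_scheme \<Rightarrow> nat \<Rightarrow> ('a \<Rightarrow> complex) \<Rightarrow> bool" where
  "character G n \<chi> \<longleftrightarrow>
     (\<forall>x\<in>carrier G. \<forall>y\<in>carrier G. \<chi> (x \<otimes>\<^bsub>G\<^esub> y) = \<chi> x * \<chi> y) \<and> (\<forall>x\<in>carrier G. \<chi> x ^ n = 1)"

lemma character_power:
  assumes "character G n \<chi>"
  shows "character G n (\<lambda>x. \<chi> x ^ d)"
proof -
  have "(\<chi> x ^ d) ^ n = 1" if "x \<in> carrier G" for x
    using assms that by (metis character_def mult.commute power_mult power_one)
  then show ?thesis
    using assms by (simp add: character_def power_mult_distrib)
qed

text \<open>Cauchy's theorem, from \<open>sylow_thm\<close> with exponent 1.\<close>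

lemma (in group) exists_element_prime_order:
  assumes p: "Factorial_Ring.prime p" and fin: "finite (carrier G)" and dvd: "p dvd card (carrier G)"
  obtains h where "h \<in> carrier G" "ord h = p"
proof -
  obtain c where c: "card (carrier G) = p * c" using dvd by blast
  obtain H where H: "subgroup H G" "card H = p"
    using sylow_thm[of p G 1 c] is_group fin p c by (auto simp: order_def)
  have "card H \<ge> 2" using p H by (simp add: prime_ge_2_nat)
  moreover have "card H \<le> 1" if "H \<subseteq> {\<one>}" using card_mono[OF _ that] by simp
  ultimately obtain h where h: "h \<in> H" "h \<noteq> \<one>" by force
  interpret H: group "G\<lparr>carrier := H\<rparr>" using H(1) by (rule subgroup.subgroup_is_group) (rule is_group)
  have "h [^]\<^bsub>G\<lparr>carrier := H\<rparr>\<^esub> order (G\<lparr>carrier := H\<rparr>) = \<one>"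
    using H.pow_order_eq_1[of h] h by simp
  then have "h [^] p = \<one>" using H(2) by (simp add: order_def flip: nat_pow_consistent)
  moreover have hG: "h \<in> carrier G" using h subgroup.mem_carrier[OF H(1)] by blast
  ultimately have "ord h dvd p" "ord h \<noteq> 1" using h pow_eq_id ord_eq_1 by auto
  then show thesis using that[OF hG] p unfolding prime_nat_iff by blast
qed

lemma (in comm_group) ord_mult_coprime:
  assumes a: "a \<in> carrier G" and b: "b \<in> carrier G" and cop: "coprime (ord a) (ord b)"
  shows "ord (a \<otimes> b) = ord a * ord b"
proof (rule dvd_antisym)
  show "ord (a \<otimes> b) dvd ord a * ord b" using a b by (rule abelian_ord_mul_divides)
  \<comment> \<open>Raising \<open>(x \<otimes> y) [^] ord (x \<otimes> y) = \<one>\<close> to the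
    power \<open>ord y\<close> eliminates \<open>y\<close>; coprimality then cancels
    \<open>ord y\<close>.\<close>
  have *: "ord x dvd ord (x \<otimes> y)"
    if x: "x \<in> carrier G" and y: "y \<in> carrier G" and c: "coprime (ord x) (ord y)" for x y
  proof -
    have "(x \<otimes> y) [^] (ord (x \<otimes> y) * ord y) = \<one>" using x y by (simp add: pow_eq_id)
    moreover have "y [^] (ord (x \<otimes> y) * ord y) = \<one>" using y by (simp add: pow_eq_id)
    ultimately have "x [^] (ord (x \<otimes> y) * ord y) = \<one>" using x y by (simp add: nat_pow_distrib)
    then have "ord x dvd ord (x \<otimes> y) * ord y" using x by (simp add: pow_eq_id)
    then show ?thesis using c by (simp add: coprime_dvd_mult_left_iff)
  qed
  have "ord b dvd ord (a \<otimes> b)"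
    using *[OF b a] cop m_comm[OF a b] by (simp add: coprime_commute)
  then show "ord a * ord b dvd ord (a \<otimes> b)"
    using *[OF a b cop] cop by (simp add: divides_mult)
qed

text \<open>\<open>x\<close> generates the group, and \<open>x [^] i\<close> is sent to the
  \<open>i\<close>-th power of a primitive root of unity; \<open>pow_eq\<close> makes this
  independent of the chosen exponent.\<close>

lemma (in group) exists_faithful_character:
  assumes x: "x \<in> carrier G" and fin: "finite (carrier G)" and ord: "ord x = card (carrier G)"
  obtains \<chi> where "character G (card (carrier G)) \<chi>"
    "\<And>d. 0 < d \<Longrightarrow> d < card (carrier G) \<Longrightarrow> \<chi> x ^ d \<noteq> 1"
proof -
  define v where "v = card (carrier G)"
  have v: "v > 0" using fin by (auto simp: v_def card_gt_0_iff)
  let ?z = "cis (2 * pi / v)"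
  have "inj_on (\<lambda>i. x [^] i) {0..v - 1}"
    using ord_inj[OF x] ord by (simp add: v_def)
  then have "card ((\<lambda>i. x [^] i) ` {0..v - 1}) = card (carrier G)"
    using v by (simp add: card_image v_def)
  then have "(\<lambda>i. x [^] i) ` {0..v - 1} = carrier G"
    using fin x by (intro card_subset_eq) auto
  then have surj: "\<exists>i::nat. g = x [^] i" if "g \<in> carrier G" for g
    using that by force
  define ind where "ind g = (SOME i::nat. g = x [^] i)" for g
  have ind: "x [^] ind g = g" if "g \<in> carrier G" for g
    using someI_ex[OF surj[OF that]] by (simp add: ind_def)
  have pow_eq: "?z ^ i = ?z ^ j" if "x [^] i = x [^] j" for i j :: nat
  proof -
    have *: "?z ^ i = ?z ^ j" if "x [^] i = x [^] j" "i \<le> j" for i j :: nat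
    proof -
      have "x [^] i \<otimes> x [^] (j - i) = x [^] j"
        using that(2) x by (simp add: nat_pow_mult)
      then have "x [^] i \<otimes> x [^] (j - i) = x [^] i"
        by (simp only: that(1))
      then have "x [^] (j - i) = \<one>"
        by (simp only: l_cancel_one nat_pow_closed x)
      then have "v dvd j - i" using x ord by (simp add: pow_eq_id v_def)
      then have "?z ^ (j - i) = 1"
        by (elim dvdE) (simp only: power_mult cis_root_power[OF v] power_one)
      then have "?z ^ (i + (j - i)) = ?z ^ i" by (simp only: power_add mult_1_right)
      then show ?thesis using that(2) by simp
    qed
    show ?thesis
      using *[OF that] *[OF that[symmetric]] nat_le_linear[of i j] by metis
  qed
  define \<chi> where "\<chi> g = ?z ^ ind g" for g
  have "\<chi> (g \<otimes> h) = \<chi> g * \<chi> h" if "g \<in> carrier G" "h \<in> carrier G" for g h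
  proof -
    have "x [^] ind (g \<otimes> h) = x [^] (ind g + ind h)"
      using that x by (simp add: ind flip: nat_pow_mult)
    from pow_eq[OF this] show ?thesis by (simp only: \<chi>_def power_add)
  qed
  moreover have "\<chi> g ^ v = 1" for g
  proof -
    have "\<chi> g ^ v = (?z ^ v) ^ ind g"
      unfolding \<chi>_def power_mult[symmetric] by (simp only: mult.commute)
    then show ?thesis by (simp only: cis_root_power[OF v] power_one)
  qed
  ultimately have "character G v \<chi>" by (simp add: character_def)
  moreover have "\<chi> x ^ d \<noteq> 1" if d: "0 < d" "d < v" for d
  proof
    assume "\<chi> x ^ d = 1"
    moreover have "\<chi> x = ?z"
    proof -
      have "x [^] ind x = x [^] (1 :: nat)" using x by (simp add: ind)
      from pow_eq[OF this] show ?thesis by (simp only: \<chi>_def power_one_right)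
    qed
    ultimately have "cis (2 * pi * real d / v) = 1" by (simp add: DeMoivre mult_ac)
    moreover have "inj_on (\<lambda>k. cis (2 * pi * real k / v)) {..<v}"
      using bij_betw_roots_unity[OF v] by (rule bij_betw_imp_inj_on)
    ultimately have "d = 0" using d v by (auto dest!: inj_onD[of _ _ d 0])
    with d show False by simp
  qed
  ultimately show thesis using that by (simp add: v_def)
qed

locale character_group = comm_group G for G (structure) +
  fixes n :: nat and \<chi> :: "'a \<Rightarrow> complex"
  assumes char: "character G n \<chi>" and n_pos: "n > 0"
begin

lemma char_mult: "x \<in> carrier G \<Longrightarrow> y \<in> carrier G \<Longrightarrow> \<chi> (x \<otimes> y) = \<chi> x * \<chi> y"
  using char by (simp add: character_def)

lemma char_root: "x \<in> carrier G \<Longrightarrow> \<chi> x ^ n = 1"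
  using char by (simp add: character_def)

lemma char_nonzero: "x \<in> carrier G \<Longrightarrow> \<chi> x \<noteq> 0"
  using char_root[of x] n_pos by (auto simp: power_0_left)

lemma char_one: "\<chi> \<one> = 1"
  using char_mult[of \<one> \<one>] char_nonzero[of \<one>] by simp

lemma char_inv:
  assumes "x \<in> carrier G" shows "\<chi> (inv x) = cnj (\<chi> x)"
proof -
  have "cmod (\<chi> x) ^ n = 1" using char_root[OF assms] by (simp flip: norm_power)
  then have "cmod (\<chi> x) = 1" using n_pos power_eq_imp_eq_base[of "cmod (\<chi> x)" n 1] by simp
  then have "\<chi> x * cnj (\<chi> x) = 1" by (simp flip: complex_norm_square)
  moreover have "\<chi> x * \<chi> (inv x) = 1" using assms by (simp add: char_one flip: char_mult)
  ultimately show ?thesis using char_nonzero[OF assms] by (metis mult_left_cancel)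
qed

lemma char_orthogonal:
  assumes a: "a \<in> carrier G" "\<chi> a \<noteq> 1"
  shows "(\<Sum>x\<in>carrier G. \<chi> x) = 0"
proof -
  have "(\<Sum>x\<in>carrier G. \<chi> (a \<otimes> x)) = (\<Sum>x\<in>carrier G. \<chi> x)"
    by (rule sum.reindex_bij_witness[of _ "\<lambda>x. inv a \<otimes> x" "\<lambda>x. a \<otimes> x"])
       (use a in \<open>auto simp flip: m_assoc\<close>)
  moreover have "(\<Sum>x\<in>carrier G. \<chi> (a \<otimes> x)) = \<chi> a * (\<Sum>x\<in>carrier G. \<chi> x)"
    using a by (simp add: char_mult sum_distrib_left)
  ultimately show ?thesis using a by (metis mult_cancel_right1)
qed

end

section \<open>Strong external difference families\<close>

locale sedf =
  fixes G :: "('a, 'b) monoid_scheme" (structure) and v m k l :: nat and D :: "nat \<Rightarrow> 'a set"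
  assumes sedf: "is_SEDF G v m k l D" and m_gt: "m > 2" and k_gt: "k > 1"

sublocale sedf \<subseteq> comm_group G
  using sedf by (simp add: is_SEDF_def)

context sedf
begin

lemma finite_G: "finite (carrier G)" and card_G: "card (carrier G) = v" and l_pos: "l \<ge> 1"
  using sedf by (auto simp: is_SEDF_def)

lemma v_pos: "v > 0"
  using finite_G one_closed unfolding card_G[symmetric] card_gt_0_iff by blast

lemma D_subset: "i \<in> {1..m} \<Longrightarrow> D i \<subseteq> carrier G" and card_D: "i \<in> {1..m} \<Longrightarrow> card (D i) = k"
  using sedf by (auto simp: is_SEDF_def)

lemma finite_D: "i \<in> {1..m} \<Longrightarrow> finite (D i)"
  using D_subset finite_G finite_subset by blast

lemma D_disjoint: "i \<in> {1..m} \<Longrightarrow> j \<in> {1..m} \<Longrightarrow> i \<noteq> j \<Longrightarrow> D i \<inter> D j = {}"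
  using sedf by (auto simp: is_SEDF_def disjoint_family_on_def)

text \<open>A linear functional applied to the group ring identity that defines the family. The
  constant 1 gives the counting equation, a character the equation for character sums.\<close>

lemma sum_differences:
  fixes f :: "'a \<Rightarrow> complex"
  assumes j: "j \<in> {1..m}"
  shows "(\<Sum>x\<in>D j. \<Sum>i\<in>{1..m} - {j}. \<Sum>y\<in>D i. f (x \<otimes> inv y)) =
    of_nat l * (\<Sum>g\<in>carrier G - {\<one>}. f g)"
proof -
  define U where "U = (\<Union>i\<in>{1..m} - {j}. D i)"
  let ?h = "\<lambda>(x, y). x \<otimes> inv y"
  have U: "U \<subseteq> carrier G" "D j \<inter> U = {}" "finite U"
    using D_subset D_disjoint[OF j] finite_D unfolding U_def by (blast, blast, auto)
  have fin: "finite (D j \<times> U)" using U finite_D[OF j] by simp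
  have h: "?h ` (D j \<times> U) \<subseteq> carrier G - {\<one>}"
  proof (clarsimp, intro conjI)
    fix x y assume xy: "x \<in> D j" "y \<in> U"
    then have c: "x \<in> carrier G" "y \<in> carrier G" using U D_subset[OF j] by auto
    then show "x \<otimes> inv y \<in> carrier G" by simp
    show "x \<otimes> inv y \<noteq> \<one>"
    proof
      assume "x \<otimes> inv y = \<one>"
      then have "x = y" using c by (metis inv_equality inv_inv inv_closed)
      then show False using xy U by blast
    qed
  qed
  have "(\<Sum>x\<in>D j. \<Sum>i\<in>{1..m} - {j}. \<Sum>y\<in>D i. f (x \<otimes> inv y)) =
      (\<Sum>x\<in>D j. \<Sum>y\<in>U. f (x \<otimes> inv y))"
    unfolding U_def using finite_D D_disjoint
    by (intro sum.cong refl sum.UNION_disjoint[symmetric]) auto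
  also have "\<dots> = (\<Sum>p\<in>D j \<times> U. f (?h p))"
    by (simp add: sum.cartesian_product case_prod_beta)
  also have "\<dots> = (\<Sum>g\<in>carrier G - {\<one>}. \<Sum>p | p \<in> D j \<times> U \<and> ?h p = g. f (?h p))"
    by (rule sum.group[symmetric, OF fin _ h]) (simp add: finite_G)
  also have "\<dots> = (\<Sum>g\<in>carrier G - {\<one>}. of_nat l * f g)"
  proof (intro sum.cong refl)
    fix g assume g: "g \<in> carrier G - {\<one>}"
    have "{p. p \<in> D j \<times> U \<and> ?h p = g} = {(x, y). x \<in> D j \<and> y \<in> U \<and> x \<otimes> inv y = g}" by auto
    then have "card {p. p \<in> D j \<times> U \<and> ?h p = g} = l"
      using sedf j g by (simp add: is_SEDF_def U_def)
    then show "(\<Sum>p | p \<in> D j \<times> U \<and> ?h p = g. f (?h p)) = of_nat l * f g" by simp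
  qed
  finally show ?thesis by (simp add: sum_distrib_left)
qed

lemma counting: "k ^ 2 * (m - 1) = l * (v - 1)"
proof -
  have j: "1 \<in> {1..m}" using m_gt by simp
  have "(\<Sum>x\<in>D 1. \<Sum>i\<in>{1..m} - {1}. \<Sum>y\<in>D i. (1 :: complex)) = of_nat (k * ((m - 1) * k))"
    using card_D[OF j] card_D j by (simp add: card_Diff_singleton)
  moreover have "(\<Sum>g\<in>carrier G - {\<one>}. (1 :: complex)) = of_nat (v - 1)"
    using finite_G by (simp add: card_G)
  ultimately have "complex_of_nat (k * ((m - 1) * k)) = of_nat (l * (v - 1))"
    using sum_differences[OF j, of "\<lambda>_. 1"] by simp
  then have "k * ((m - 1) * k) = l * (v - 1)" by (simp only: of_nat_eq_iff)
  then show ?thesis by (simp add: power2_eq_square mult_ac)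
qed

lemma mk_less: "m * k < v"
proof -
  have "card (\<Union>i\<in>{1..m}. D i) = (\<Sum>i\<in>{1..m}. card (D i))"
    using finite_D D_disjoint by (intro card_UN_disjoint) auto
  also have "\<dots> = m * k" using card_D by simp
  finally have "card (\<Union>i\<in>{1..m}. D i) = m * k" .
  moreover have "(\<Union>i\<in>{1..m}. D i) \<subseteq> carrier G" using D_subset by blast
  ultimately have "m * k \<le> v"
    using card_mono[OF finite_G, of "\<Union>i\<in>{1..m}. D i"] by (simp only: card_G)
  \<comment> \<open>Equality would make \<open>v - 1\<close> coprime to \<open>k\<close>, so by the
    counting equation it would divide the smaller number \<open>m - 1\<close>.\<close>
  moreover have "m * k \<noteq> v"
  proof
    assume v: "m * k = v"
    have "coprime (v - 1) v" using v_pos by (rule coprime_diff_one_left_nat)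
    then have "coprime (v - 1) (k ^ 2)" unfolding v[symmetric] by simp
    moreover have "v - 1 dvd k ^ 2 * (m - 1)" using counting by simp
    ultimately have "v - 1 dvd m - 1" by (simp add: coprime_dvd_mult_right_iff)
    then have "v - 1 \<le> m - 1" using m_gt by (intro dvd_imp_le) auto
    moreover have "m * 2 \<le> m * k" using k_gt by simp
    ultimately show False using v m_gt by simp
  qed
  ultimately show ?thesis by simp
qed

text \<open>\<open>mk_less\<close> gives \<open>k * (m - 1) < v - 1\<close>; multiply by
  \<open>k\<close> and compare with the counting equation.\<close>

lemma l_less: "l < k"
proof -
  have "k * (m - 1) = m * k - k" by (simp add: diff_mult_distrib2 mult.commute)
  moreover have "k \<le> m * k" using m_gt by simp
  ultimately have "k * (m - 1) < v - 1" using mk_less k_gt by linarith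
  then have "k * (k * (m - 1)) < k * (v - 1)" using k_gt by simp
  then have "l * (v - 1) < k * (v - 1)" using counting by (simp only: power2_eq_square mult.assoc)
  then show ?thesis by simp
qed

lemma l_cong: "p dvd v \<Longrightarrow> int p dvd int k ^ 2 * (int m - 1) + int l"
proof -
  assume "p dvd v"
  have "int (k ^ 2 * (m - 1)) = int (l * (v - 1))" by (simp only: counting)
  then have "int k ^ 2 * (int m - 1) + int l = int l * int v"
    using m_gt v_pos by (simp add: of_nat_diff algebra_simps)
  then show ?thesis using \<open>p dvd v\<close> by simp
qed

text \<open>By the counting equation such a prime would divide \<open>m - 1\<close>, which is
  coprime to both \<open>m\<close> and \<open>m - 2\<close>.\<close>

lemma prime_not_dvd_l:
  assumes p: "Factorial_Ring.prime p" "p dvd v" "\<not> p dvd k" and pm: "p dvd m \<or> p dvd m - 2"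
  shows "\<not> p dvd l"
proof
  assume "p dvd l"
  then have "p dvd k ^ 2 * (m - 1)" unfolding counting by simp
  then have pm1: "p dvd m - 1" using p prime_dvd_mult_iff prime_dvd_power by blast
  have "m - (m - 1) = 1" "m - 1 - (m - 2) = 1" using m_gt by auto
  then have "p dvd 1" using pm pm1 dvd_diff_nat by metis
  then show False using p(1) by simp
qed

definition csum :: "('a \<Rightarrow> complex) \<Rightarrow> nat \<Rightarrow> complex" where
  "csum \<chi> i = (\<Sum>x\<in>D i. \<chi> x)"

lemma csum_cyclotomic:
  assumes "character G v \<chi>" "i \<in> {1..m}"
  shows "csum \<chi> i \<in> cyclotomic v"
  unfolding csum_def
  by (intro cyclotomic_sum root_of_unity_in_cyclotomic[OF v_pos])
     (use assms(1) D_subset[OF assms(2)] in \<open>auto simp: character_def\<close>)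

lemma csum_frobenius:
  assumes "Factorial_Ring.prime q" "character G v \<chi>" "i \<in> {1..m}"
  shows "cyclotomic_cong v q (csum \<chi> i ^ q) (csum (\<lambda>x. \<chi> x ^ q) i)"
  unfolding csum_def
  by (intro cyclotomic_frobenius_sum root_of_unity_in_cyclotomic[OF v_pos])
     (use assms finite_D D_subset[OF assms(3)] in \<open>auto simp: character_def\<close>)

lemma csum_trivial: "(\<And>x. x \<in> carrier G \<Longrightarrow> \<chi> x = 1) \<Longrightarrow> i \<in> {1..m} \<Longrightarrow> csum \<chi> i = of_nat k"
  using D_subset[of i] card_D[of i] by (simp add: csum_def subset_iff)

lemma csum_norm_cong:
  assumes q: "Factorial_Ring.prime q" and \<chi>: "character G v \<chi>" and i: "i \<in> {1..m}"
    and "csum \<chi> i * cnj (csum \<chi> i) = of_nat N"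
    and "csum (\<lambda>x. \<chi> x ^ q) i * cnj (csum (\<lambda>x. \<chi> x ^ q) i) = of_nat N'"
  shows "[N = N'] (mod q)"
proof -
  have "[int N = int N'] (mod int q)"
    using assms
    by (intro cyclotomic_norm_cong[OF v_pos q csum_cyclotomic csum_cyclotomic csum_frobenius])
       (auto intro: character_power)
  then show ?thesis by (simp add: cong_int_iff)
qed

lemma csum_diff_norm_cong:
  assumes q: "Factorial_Ring.prime q" and \<chi>: "character G v \<chi>" and i: "i \<in> {1..m}" and j: "j \<in> {1..m}"
  defines "z \<equiv> csum \<chi> i - csum \<chi> j"
    and "z' \<equiv> csum (\<lambda>x. \<chi> x ^ q) i - csum (\<lambda>x. \<chi> x ^ q) j"
  assumes "z * cnj z = of_nat N" "z' * cnj z' = of_nat N'"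
  shows "[N = N'] (mod q)"
proof -
  have "cyclotomic_cong v q (z ^ q) z'"
    unfolding z_def z'_def
    by (intro cyclotomic_frobenius_diff[OF q] csum_cyclotomic csum_frobenius q \<chi> i j)
  moreover have "z \<in> cyclotomic v" "z' \<in> cyclotomic v"
    unfolding z_def z'_def by (intro cyclotomic_diff csum_cyclotomic character_power \<chi> i j)+
  ultimately have "[int N = int N'] (mod int q)"
    using assms by (intro cyclotomic_norm_cong[OF v_pos q]) auto
  then show ?thesis by (simp add: cong_int_iff)
qed

text \<open>\<open>sum_differences\<close> for \<open>\<chi>\<close>; by orthogonality the sum over
  the non-identity elements is \<open>- 1\<close>.\<close>

lemma csum_equation:
  assumes \<chi>: "character G v \<chi>" and nt: "\<exists>x\<in>carrier G. \<chi> x \<noteq> 1" and j: "j \<in> {1..m}"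
  shows "csum \<chi> j * cnj (\<Sum>i\<in>{1..m}. csum \<chi> i) - csum \<chi> j * cnj (csum \<chi> j) = - of_nat l"
proof -
  interpret character_group G v \<chi>
    by unfold_locales (use \<chi> v_pos in auto)
  have "(\<Sum>i\<in>{1..m}. csum \<chi> i) = csum \<chi> j + (\<Sum>i\<in>{1..m} - {j}. csum \<chi> i)"
    using j by (intro sum.remove) auto
  then have "csum \<chi> j * cnj (\<Sum>i\<in>{1..m}. csum \<chi> i) - csum \<chi> j * cnj (csum \<chi> j) =
      csum \<chi> j * cnj (\<Sum>i\<in>{1..m} - {j}. csum \<chi> i)"
    by (simp add: algebra_simps)
  also have "\<dots> = (\<Sum>x\<in>D j. \<Sum>i\<in>{1..m} - {j}. \<Sum>y\<in>D i. \<chi> x * cnj (\<chi> y))"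
    by (simp only: csum_def cnj_sum sum_distrib_right) (simp only: sum_distrib_left)
  also have "\<dots> = (\<Sum>x\<in>D j. \<Sum>i\<in>{1..m} - {j}. \<Sum>y\<in>D i. \<chi> (x \<otimes> inv y))"
    using D_subset j by (intro sum.cong refl) (auto simp: char_mult char_inv subset_iff)
  also have "\<dots> = of_nat l * (\<Sum>g\<in>carrier G - {\<one>}. \<chi> g)"
    using j by (rule sum_differences)
  also have "(\<Sum>g\<in>carrier G - {\<one>}. \<chi> g) = - 1"
    using nt char_orthogonal finite_G by (auto simp: sum_diff1 char_one)
  finally show ?thesis by simp
qed

lemma csum_cases:
  assumes \<chi>: "character G v \<chi>" and nt: "\<exists>x\<in>carrier G. \<chi> x \<noteq> 1"
  obtains (zero) "\<And>i. i \<in> {1..m} \<Longrightarrow> csum \<chi> i * cnj (csum \<chi> i) = of_nat l"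
  | (two) A u w n y where "two_valued m (csum \<chi>) A u w n y" "l = u * w * n"
  by (rule character_values_cases[OF m_gt l_pos v_pos csum_cyclotomic[OF \<chi>] csum_equation[OF \<chi> nt]])
     (use that in blast)+

end

section \<open>Squared absolute values in the two-valued case\<close>

lemma two_valued_dvd: "two_valued m z A u w n y \<Longrightarrow> u + w dvd m - 2"
  unfolding two_valued_def by (metis dvd_triv_left)

lemma two_valued_plus:
  assumes "two_valued m z A u w n y" "i \<in> A"
  shows "z i * cnj (z i) = of_nat (u ^ 2 * n)"
proof -
  have "z i * cnj (z i) = of_nat (u ^ 2) * (y * cnj y)"
    using assms by (simp add: two_valued_def power2_eq_square mult_ac)
  then show ?thesis using assms(1) by (simp add: two_valued_def)
qed

text \<open>Values in one class agree, values in different classes differ by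
  \<open>(u + w) * y\<close> up to sign; squared differences thus detect the partition.\<close>

lemma two_valued_diff:
  assumes "two_valued m z A u w n y" "i \<in> {1..m}" "j \<in> {1..m}"
  shows "(z i - z j) * cnj (z i - z j) = of_nat (if i \<in> A \<longleftrightarrow> j \<in> A then 0 else (u + w) ^ 2 * n)"
proof -
  have y: "y * cnj y = of_nat n" using assms(1) by (simp add: two_valued_def)
  have *: "(a * y) * cnj (a * y) = of_nat ((u + w) ^ 2 * n)"
    if "a = of_nat (u + w) \<or> a = - of_nat (u + w)" for a
  proof -
    have "(a * y) * cnj (a * y) = (a * cnj a) * (y * cnj y)" by (simp add: mult_ac)
    moreover have "a * cnj a = of_nat ((u + w) ^ 2)" using that by (elim disjE) (simp_all add: power2_eq_square del: of_nat_add)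
    ultimately show ?thesis using y by simp
  qed
  have "z a = (if a \<in> A then of_nat u * y else - (of_nat w * y))" if "a \<in> {1..m}" for a
    using assms(1) that by (auto simp: two_valued_def)
  then have z: "z i = (if i \<in> A then of_nat u * y else - (of_nat w * y))"
      "z j = (if j \<in> A then of_nat u * y else - (of_nat w * y))"
    using assms(2,3) by blast+
  show ?thesis
  proof (cases "i \<in> A \<longleftrightarrow> j \<in> A")
    case True
    then have "z i - z j = 0" using z by auto
    with True show ?thesis by simp
  next
    case False
    then have "z i - z j = of_nat (u + w) * y \<or> z i - z j = - of_nat (u + w) * y"
      unfolding z by (auto simp: algebra_simps)
    then show ?thesis
      using *[of "of_nat (u + w)"] *[of "- of_nat (u + w)"] False by (simp only: if_False) metis
  qed
qed

text \<open>\<open>card A\<close> and \<open>m\<close> determine \<open>w * g\<close> and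
  \<open>u * g\<close>, hence the ratio of \<open>u\<close> and \<open>w\<close>.\<close>

lemma two_valued_same_support:
  assumes z: "two_valued m z A u w n y" and z': "two_valued m z' A u' w' n' y'" and m: "m > 2"
  shows "u * w' = u' * w"
proof -
  obtain g g' where g: "(u + w) * g = m - 2" "card A = 1 + w * g"
      "(u' + w') * g' = m - 2" "card A = 1 + w' * g'"
    using z z' unfolding two_valued_def by blast
  then have w: "w * g = w' * g'" by simp
  have "u * g + w * g = u' * g' + w' * g'" using g by (simp add: algebra_simps)
  then have u: "u * g = u' * g'" using w by simp
  have "(u * w') * (g * g') = (u * g) * (w' * g')" by (simp add: mult_ac)
  also have "\<dots> = (u' * w) * (g * g')" unfolding u w[symmetric] by (simp add: mult_ac)
  finally show ?thesis using g m by auto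
qed

section \<open>Comparison of characters with their powers of prime exponent\<close>

context sedf
begin

text \<open>Reduction modulo a prime above \<open>p\<close> sends a character of order \<open>p\<close> to the trivial one.\<close>
lemma prime_order_character:
  assumes p: "Factorial_Ring.prime p" "p dvd v" "\<not> p dvd k" and \<chi>: "character G v \<chi>"
    and nt: "\<exists>x\<in>carrier G. \<chi> x \<noteq> 1" and triv: "\<And>x. x \<in> carrier G \<Longrightarrow> \<chi> x ^ p = 1"
  obtains (zero) "p dvd m" "\<And>i. i \<in> {1..m} \<Longrightarrow> csum \<chi> i * cnj (csum \<chi> i) = of_nat l"
  | (two) A u w n y where "two_valued m (csum \<chi>) A u w n y" "l = u * w * n" "p dvd u + w"
  using \<chi> nt
proof (cases rule: csum_cases)
  case zero
  have "csum (\<lambda>x. \<chi> x ^ p) 1 * cnj (csum (\<lambda>x. \<chi> x ^ p) 1) = of_nat (k ^ 2)"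
    using csum_trivial[of "\<lambda>x. \<chi> x ^ p" 1] triv m_gt by (simp add: power2_eq_square)
  then have "[l = k ^ 2] (mod p)"
    using csum_norm_cong[OF p(1) \<chi>, of 1 l "k ^ 2"] zero[of 1] m_gt by simp
  \<comment> \<open>Modulo \<open>p\<close>, \<open>l\<close> is \<open>k ^ 2\<close> by this
    comparison and \<open>- k ^ 2 * (m - 1)\<close> by the counting equation; subtracting leaves
    \<open>k ^ 2 * m\<close>.\<close>
  then have "int p dvd int l - int (k ^ 2)"
    by (simp add: cong_iff_dvd_diff flip: cong_int_iff)
  then have "int p dvd (int k ^ 2 * (int m - 1) + int l) - (int l - int (k ^ 2))"
    by (rule dvd_diff[OF l_cong[OF p(2)]])
  also have "\<dots> = int (k ^ 2 * m)" by (simp add: algebra_simps)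
  finally have "p dvd k ^ 2 * m" by (simp only: int_dvd_int_iff)
  then have "p dvd m" using p prime_dvd_mult_iff prime_dvd_power by blast
  then show thesis using that(1) zero by blast
next
  case (two A u w n y)
  have A: "A \<subseteq> {1..m}" "A \<noteq> {}" "2 * card A < m" using two(1) by (auto simp: two_valued_def)
  then obtain i where i: "i \<in> A" "i \<in> {1..m}" by blast
  have "A \<noteq> {1..m}" using A by auto
  then obtain j where j: "j \<notin> A" "j \<in> {1..m}" using A by blast
  \<comment> \<open>The trivial character takes the value \<open>k\<close> on every block, so the
    squared difference between the two classes is 0 modulo \<open>p\<close>.\<close>
  have "[(u + w) ^ 2 * n = 0] (mod p)"
    using csum_diff_norm_cong[OF p(1) \<chi> i(2) j(2), of "(u + w) ^ 2 * n" 0]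
      two_valued_diff[OF two(1) i(2) j(2)] i j csum_trivial[of "\<lambda>x. \<chi> x ^ p"] triv by simp
  then have "p dvd (u + w) ^ 2 * n" by (simp add: cong_0_iff)
  moreover have "\<not> p dvd n"
  proof
    assume "p dvd n"
    have "csum (\<lambda>x. \<chi> x ^ p) i * cnj (csum (\<lambda>x. \<chi> x ^ p) i) = of_nat (k ^ 2)"
      using csum_trivial[of "\<lambda>x. \<chi> x ^ p" i] triv i by (simp add: power2_eq_square)
    then have "[u ^ 2 * n = k ^ 2] (mod p)"
      by (rule csum_norm_cong[OF p(1) \<chi> i(2) two_valued_plus[OF two(1) i(1)]])
    then have "p dvd k ^ 2" using \<open>p dvd n\<close> cong_dvd_iff by fastforce
    then show False using p prime_dvd_power by blast
  qed
  ultimately have "p dvd u + w" using p(1) prime_dvd_mult_iff prime_dvd_power by blast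
  then show thesis using that(2) two by blast
qed

text \<open>The \<open>q\<close>-th power of \<open>\<chi>\<close> has order \<open>r\<close> and is
  two-valued since \<open>r\<close> does not divide \<open>m\<close>; the \<open>r\<close>-th power
  has order \<open>q\<close> and constant norm \<open>l\<close> since \<open>q\<close> does not
  divide \<open>m - 2\<close>. Comparison with both excludes either type for
  \<open>\<chi>\<close>.\<close>

lemma mixed_order_character:
  assumes q: "Factorial_Ring.prime q" "q dvd v" "\<not> q dvd k" "q dvd m" "k < q"
    and r: "Factorial_Ring.prime r" "r dvd v" "\<not> r dvd k" "r dvd m - 2" "r \<noteq> 2"
    and \<chi>: "character G v \<chi>" and triv: "\<And>x. x \<in> carrier G \<Longrightarrow> \<chi> x ^ (q * r) = 1"
    and nt: "\<exists>x\<in>carrier G. \<chi> x ^ q \<noteq> 1" "\<exists>x\<in>carrier G. \<chi> x ^ r \<noteq> 1"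
  shows False
proof -
  have q2: "\<not> q dvd m - 2" and r2: "\<not> r dvd m"
  proof -
    \<comment> \<open>Only 2 can divide both numbers, and \<open>q > k > 1\<close> and
      \<open>r \<noteq> 2\<close> rule it out.\<close>
    have *: "s = 2" if "Factorial_Ring.prime s" "s dvd m" "s dvd m - 2" for s :: nat
    proof -
      have "s dvd m - (m - 2)" by (rule dvd_diff_nat[OF that(2,3)])
      moreover have "m - (m - 2) = 2" using m_gt by simp
      ultimately have "s dvd 2" by metis
      then show ?thesis using that(1) by (simp add: primes_dvd_imp_eq)
    qed
    show "\<not> q dvd m - 2" using *[of q] q k_gt by auto
    show "\<not> r dvd m" using *[of r] r by auto
  qed
  have ql: "\<not> q dvd l" and rl: "\<not> r dvd l"
    using prime_not_dvd_l q r by blast+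
  let ?\<chi>r = "\<lambda>x. \<chi> x ^ q" and ?\<chi>q = "\<lambda>x. \<chi> x ^ r"
  have trivr: "(\<chi> x ^ q) ^ r = 1" and trivq: "(\<chi> x ^ r) ^ q = 1" if "x \<in> carrier G" for x
    using triv[OF that] by (simp_all add: mult.commute flip: power_mult)
  obtain A u w n y where two: "two_valued m (csum ?\<chi>r) A u w n y" "l = u * w * n" "r dvd u + w"
    using prime_order_character[OF r(1-3) character_power[OF \<chi>] nt(1) trivr] r2 by metis
  have zero: "csum ?\<chi>q i * cnj (csum ?\<chi>q i) = of_nat l" if "i \<in> {1..m}" for i
    using prime_order_character[OF q(1-3) character_power[OF \<chi>] nt(2) trivq] q2 that
    by (metis dvd_trans two_valued_dvd)
  have nt': "\<exists>x\<in>carrier G. \<chi> x \<noteq> 1" using nt(1) by (metis power_one)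
  have A: "A \<subseteq> {1..m}" "A \<noteq> {}" "2 * card A < m" and uw: "1 \<le> w" "w < u" "coprime u w"
    using two(1) by (auto simp: two_valued_def)
  from \<chi> nt' show False
  proof (cases rule: csum_cases)
    case psi: zero
    obtain i where i: "i \<in> A" "i \<in> {1..m}" using A by blast
    \<comment> \<open>This leaves \<open>q dvd u - w\<close>, although
      \<open>0 < u - w < u \<le> l < k < q\<close>.\<close>
    have "[l = u ^ 2 * n] (mod q)"
      by (rule csum_norm_cong[OF q(1) \<chi> i(2) psi[OF i(2)] two_valued_plus[OF two(1) i(1)]])
    then have "int q dvd int (u ^ 2 * n) - int l"
      by (meson cong_iff_dvd_diff cong_int_iff cong_sym)
    also have "int (u ^ 2 * n) - int l = int (u * n * (u - w))"
      using uw by (simp add: two(2) of_nat_diff power2_eq_square algebra_simps)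
    finally have "q dvd u * n * (u - w)" by (simp only: int_dvd_int_iff)
    moreover have "\<not> q dvd u * n" using ql dvd_mult[of q "u * n" w] by (simp only: two(2) mult_ac) blast
    ultimately have "q dvd u - w" using q(1) prime_dvd_mult_iff by blast
    then have "q \<le> u - w" using uw by (intro dvd_imp_le) auto
    moreover have "u \<le> l" using uw l_pos by (auto simp: two(2))
    ultimately show False using l_less q(5) by simp
  next
    case psi: (two A' u' w' n' y')
    have A': "A' \<subseteq> {1..m}" "A' \<noteq> {}" "2 * card A' < m" and uw': "1 \<le> w'" "w' < u'" "coprime u' w'"
      using psi(1) by (auto simp: two_valued_def)
    obtain i where i: "i \<in> A'" "i \<in> {1..m}" using A' by blast
    \<comment> \<open>Comparison with the \<open>r\<close>-th power makes \<open>u'\<close> and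
      \<open>w'\<close> congruent modulo \<open>r\<close>.\<close>
    have "[u' ^ 2 * n' = l] (mod r)"
      by (rule csum_norm_cong[OF r(1) \<chi> i(2) two_valued_plus[OF psi(1) i(1)] zero[OF i(2)]])
    then have "int r dvd int (u' ^ 2 * n') - int l"
      by (meson cong_iff_dvd_diff cong_int_iff)
    also have "int (u' ^ 2 * n') - int l = int (u' * n' * (u' - w'))"
      using uw' by (simp add: psi(2) of_nat_diff power2_eq_square algebra_simps)
    finally have "r dvd u' * n' * (u' - w')" by (simp only: int_dvd_int_iff)
    moreover have "\<not> r dvd u' * n'" using rl dvd_mult[of r "u' * n'" w'] by (simp only: psi(2) mult_ac) blast
    ultimately have r': "r dvd u' - w'" using r(1) prime_dvd_mult_iff by blast
    have qn: "\<not> q dvd (u + w) ^ 2 * n" "\<not> q dvd (u' + w') ^ 2 * n'"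
    proof -
      have "\<not> q dvd u + w" "\<not> q dvd u' + w'"
        using q2 two_valued_dvd two(1) psi(1) dvd_trans by blast+
      moreover have "\<not> q dvd n" "\<not> q dvd n'"
        using ql two(2) psi(2) by (metis dvd_mult)+
      ultimately show "\<not> q dvd (u + w) ^ 2 * n" "\<not> q dvd (u' + w') ^ 2 * n'"
        using q(1) prime_dvd_mult_iff prime_dvd_power by blast+
    qed
    \<comment> \<open>Squared differences are 0 within a class and nonzero modulo \<open>q\<close>
      across classes, so \<open>\<chi>\<close> and its \<open>q\<close>-th power induce the same
      partition.\<close>
    have classes: "(i \<in> A \<longleftrightarrow> j \<in> A) \<longleftrightarrow> (i \<in> A' \<longleftrightarrow> j \<in> A')" if "i \<in> {1..m}" "j \<in> {1..m}" for i j
    proof -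
      have "[(if i \<in> A' \<longleftrightarrow> j \<in> A' then 0 else (u' + w') ^ 2 * n') =
          (if i \<in> A \<longleftrightarrow> j \<in> A then 0 else (u + w) ^ 2 * n)] (mod q)"
        by (rule csum_diff_norm_cong[OF q(1) \<chi> that two_valued_diff[OF psi(1) that]
              two_valued_diff[OF two(1) that]])
      then show ?thesis using qn by (auto simp: cong_0_iff cong_sym_eq[of 0] split: if_splits)
    qed
    obtain a where a: "a \<in> A" "a \<in> {1..m}" using A by blast
    have "A' = A"
    proof (cases "a \<in> A'")
      case True
      then show ?thesis using classes[OF a(2)] a A(1) A'(1) by blast
    next
      case False
      \<comment> \<open>Complementary sets are impossible, as \<open>A\<close> and \<open>A'\<close>
        both have fewer than \<open>m / 2\<close> elements.\<close>
      then have "A' = {1..m} - A" using classes[OF a(2)] a A(1) A'(1) by blast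
      then have "card A' = m - card A" using A(1) by (simp add: card_Diff_subset finite_subset)
      then show ?thesis using A(3) A'(3) by simp
    qed
    then have "u * w' = u' * w"
      using two_valued_same_support[OF two(1) _ m_gt] psi(1) by blast
    \<comment> \<open>Modulo \<open>r\<close>, \<open>u = - w\<close> and \<open>u' = w'\<close>,
      while \<open>u * w' = u' * w\<close>; so \<open>2 * u * w'\<close> vanishes, against
      coprimality and \<open>r \<noteq> 2\<close>.\<close>
    have "r dvd w' * (u + w) + w * (u' - w')"
      by (rule dvd_add[OF dvd_mult[OF two(3)] dvd_mult[OF r']])
    also have "w' * (u + w) + w * (u' - w') = u * w' + u' * w"
      using uw' by (simp add: algebra_simps)
    finally have "r dvd 2 * (u * w')" using \<open>u * w' = u' * w\<close> by (simp add: mult_2)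
    moreover have "\<not> r dvd 2" using r(1,5) primes_dvd_imp_eq two_is_prime_nat by blast
    ultimately consider "r dvd u" | "r dvd w'" using r(1) prime_dvd_mult_iff by blast
    then show False
    proof cases
      case 1
      then have "r dvd w" using two(3) by (simp add: dvd_add_right_iff)
      with 1 have "r dvd 1" using uw(3) coprime_common_divisor by blast
      then show False using r(1) by simp
    next
      case 2
      then have "r dvd u' - w' + w'" using r' by (intro dvd_add)
      then have "r dvd u'" using uw' by simp
      with 2 have "r dvd 1" using uw'(3) coprime_common_divisor by blast
      then show False using r(1) by simp
    qed
  qed
qed

text \<open>The power \<open>v / p\<close> of a faithful character has order \<open>p\<close>; of
  the two-valued case only the arithmetic is kept.\<close>

lemma prime_dvd_cases:
  assumes \<chi>: "character G v \<chi>" and faithful: "\<And>d. 0 < d \<Longrightarrow> d < v \<Longrightarrow> \<exists>x\<in>carrier G. \<chi> x ^ d \<noteq> 1"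
    and p: "Factorial_Ring.prime p" "p dvd v" "\<not> p dvd k"
  obtains (zero) "p dvd m"
  | (two) u w n where "l = u * w * n" "1 \<le> w" "p dvd u + w" "u + w dvd m - 2"
proof -
  obtain d where d: "v = p * d" using p(2) by blast
  have d0: "0 < d" "d < v" using d v_pos p(1) prime_gt_1_nat[OF p(1)] by auto
  have triv: "(\<chi> x ^ d) ^ p = 1" if "x \<in> carrier G" for x
    using \<chi> that by (simp add: character_def d mult.commute flip: power_mult)
  show thesis
  proof (rule prime_order_character[OF p character_power[OF \<chi>] faithful[OF d0] triv])
    assume "p dvd m"
    then show thesis by (rule zero)
  next
    fix A u w n y
    assume *: "two_valued m (csum (\<lambda>x. \<chi> x ^ d)) A u w n y" "l = u * w * n" "p dvd u + w"
    then have "1 \<le> w" by (simp add: two_valued_def)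
    then show thesis using two[OF *(2) _ *(3) two_valued_dvd[OF *(1)]] by blast
  qed
qed

section \<open>Distribution of the three primes over \<open>k\<close>, \<open>m\<close> and
  \<open>m - 2\<close>\<close>

context
  fixes \<chi> :: "'a \<Rightarrow> complex"
  assumes \<chi>: "character G v \<chi>"
    and faithful: "\<And>d. 0 < d \<Longrightarrow> d < v \<Longrightarrow> \<exists>x\<in>carrier G. \<chi> x ^ d \<noteq> 1"
begin

lemma prime_dvd_m:
  assumes "Factorial_Ring.prime p" "p dvd v" "\<not> p dvd k"
  shows "p dvd m \<or> p dvd m - 2"
  using prime_dvd_cases[OF \<chi> faithful assms] dvd_trans by metis

text \<open>Either \<open>r\<close> also divides \<open>k\<close> and \<open>k \<ge> v\<close>, or
  \<open>r \<le> m\<close> and \<open>p * q \<le> k\<close>; both contradict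
  \<open>m * k < v\<close>.\<close>

lemma two_primes_dvd_k:
  assumes v: "v = p * q * r" and primes: "Factorial_Ring.prime p" "Factorial_Ring.prime q"
    "Factorial_Ring.prime r" "p \<noteq> q" "p \<noteq> r" "q \<noteq> r" and pk: "p dvd k" and qk: "q dvd k"
  shows False
proof -
  have "coprime p q" using primes by (simp add: primes_coprime)
  then have pqk: "p * q dvd k" using pk qk by (simp add: divides_mult)
  have *: "\<not> s * (p * q) \<le> m * k" if "r \<le> s" for s
    using mk_less that by (metis v leD le_trans mult.commute mult_le_mono1)
  show False
  proof (cases "r dvd k")
    case True
    moreover have "coprime (p * q) r" using primes by (simp add: primes_coprime)
    ultimately have "p * q * r dvd k" using pqk by (simp add: divides_mult)
    then have "v \<le> k" using k_gt v by (auto dest: dvd_imp_le)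
    moreover have "1 * k \<le> m * k" using m_gt by (intro mult_le_mono1) simp
    ultimately show False using mk_less by simp
  next
    case False
    then have "r dvd m \<or> r dvd m - 2" using prime_dvd_m[of r] primes v by simp
    then have "r \<le> m" using m_gt dvd_imp_le[of r m] dvd_imp_le[of r "m - 2"] by auto
    moreover have "p * q \<le> k" using pqk k_gt by (auto dest: dvd_imp_le)
    ultimately show False using *[of m] by simp
  qed
qed

text \<open>\<open>p\<close> is coprime to \<open>v - 1\<close>, so the counting equation gives
  \<open>p ^ 2 dvd l\<close>. The quotients \<open>k' = k / p\<close> and
  \<open>l' = l / p ^ 2\<close> satisfy the same equation, and \<open>l < k\<close> becomes
  \<open>p * l' < k'\<close>.\<close>

lemma one_prime_dvd_k_mixed:
  assumes v: "v = p * q * r" and primes: "Factorial_Ring.prime p"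
    and pk: "p dvd k" and qm: "q dvd m" and rm: "r dvd m - 2"
  shows False
proof -
  obtain k' where k': "k = p * k'" using pk by blast
  have p2: "p \<ge> 2" using primes by (simp add: prime_ge_2_nat)
  have "coprime v (v - 1)" using v_pos by (rule coprime_diff_one_right_nat)
  then have "coprime (p ^ 2) (v - 1)" unfolding v by simp
  moreover have "p ^ 2 dvd l * (v - 1)"
    unfolding counting[symmetric] k' by (simp add: power_mult_distrib)
  ultimately have "p ^ 2 dvd l" by (simp add: coprime_dvd_mult_left_iff)
  then obtain l' where l': "l = p ^ 2 * l'" by blast
  obtain a where a: "m = q * a" using qm by blast
  obtain b where b: "m - 2 = r * b" using rm by blast
  have "p ^ 2 * (k' ^ 2 * (m - 1)) = p ^ 2 * (l' * (v - 1))"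
    using counting unfolding k' l' by (simp only: power_mult_distrib mult.assoc)
  then have count: "k' ^ 2 * (m - 1) = l' * (v - 1)" using p2 by simp
  have "p * (p * l') < p * k'" using l_less by (simp add: k' l' power2_eq_square mult.assoc)
  then have kl: "p * l' < k'" by simp
  show False
  proof (rule one_prime_parameters[of "int p" "int k'" "int l'" "int a" "int b" "int m" "int q" "int r"])
    show "int m = int q * int a" by (simp add: a)
    have "int (m - 2) = int (r * b)" by (simp only: b)
    then show "int m - 2 = int r * int b" using m_gt by (simp add: of_nat_diff)
    have "int (k' ^ 2 * (m - 1)) = int (l' * (v - 1))" by (simp only: count)
    then show "int k' ^ 2 * (int m - 1) = int l' * (int p * int q * int r - 1)"
      using m_gt v_pos v by (simp add: of_nat_diff)
    have "m * k > 1 * 1" using m_gt k_gt by (intro mult_strict_mono) auto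
    then have "v > 1" using mk_less by simp
    then have "int v > 1" by simp
    then show "int p * int q * int r > 1" by (simp add: v)
    have "int (p * l') \<le> int k'" using kl by (simp only: of_nat_le_iff less_imp_le)
    then show "int p * int l' \<le> int k'" by simp
    show "int k' \<ge> 1" using kl by simp
    show "int l' \<ge> 1" using l_pos l' by (cases l') auto
    show "int a \<ge> 1" using a m_gt by (cases a) auto
    show "int b \<ge> 1" using b m_gt by (cases b) auto
    show "int p \<ge> 2" using p2 by simp
  qed
qed

text \<open>If \<open>q\<close> and \<open>r\<close> divided the same one of \<open>m\<close> and
  \<open>m - 2\<close>, then \<open>q * r \<le> m\<close> and \<open>p \<le> k\<close> would
  contradict \<open>m * k < v\<close>; only the mixed case is left.\<close>

lemma one_prime_dvd_k:
  assumes v: "v = p * q * r" and primes: "Factorial_Ring.prime p" "Factorial_Ring.prime q"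
    "Factorial_Ring.prime r" "p \<noteq> q" "p \<noteq> r" "q \<noteq> r"
    and pk: "p dvd k" and nk: "\<not> q dvd k" "\<not> r dvd k"
  shows False
proof -
  have "q dvd m \<or> q dvd m - 2" "r dvd m \<or> r dvd m - 2"
    using prime_dvd_m[of q] prime_dvd_m[of r] primes v nk by auto
  moreover have "\<not> (q dvd s \<and> r dvd s)" if s: "s = m \<or> s = m - 2" for s
  proof
    assume "q dvd s \<and> r dvd s"
    moreover have "coprime q r" using primes by (simp add: primes_coprime)
    ultimately have "q * r dvd s" by (simp add: divides_mult)
    then have "q * r \<le> s" using s m_gt by (intro dvd_imp_le) auto
    then have "q * r \<le> m" using s by auto
    moreover have "p \<le> k" using pk k_gt by (intro dvd_imp_le) auto
    ultimately have "q * r * p \<le> m * k" by (rule mult_le_mono)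
    then show False using mk_less v by (simp add: mult_ac)
  qed
  ultimately show False
    using one_prime_dvd_k_mixed[of p q r] one_prime_dvd_k_mixed[of p r q] primes(1) pk v
    by (auto simp: mult_ac)
qed

text \<open>\<open>p * q \<le> m\<close> yields \<open>k < r\<close>, whereas a character of order
  \<open>r\<close> is two-valued and gives
  \<open>r \<le> u + w \<le> u * w + 1 \<le> l + 1 \<le> k\<close>.\<close>

lemma no_prime_dvd_k_two_one:
  assumes v: "v = p * q * r" and primes: "Factorial_Ring.prime p" "Factorial_Ring.prime q"
    "Factorial_Ring.prime r" "p \<noteq> q" and rk: "\<not> r dvd k"
    and m: "p dvd m" "q dvd m" "r dvd m - 2"
  shows False
proof -
  have "coprime p q" using primes by (simp add: primes_coprime)
  then have "p * q dvd m" using m by (simp add: divides_mult)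
  then have "p * q \<le> m" using m_gt by (intro dvd_imp_le) auto
  then have "p * q * k \<le> m * k" by (rule mult_le_mono1)
  also have "m * k < p * q * r" using mk_less v by simp
  finally have "p * q * k < p * q * r" .
  then have kr: "k < r" by simp
  have "\<not> r dvd m"
  proof
    assume "r dvd m"
    then have "r dvd m - (m - 2)" by (rule dvd_diff_nat) (rule m)
    moreover have "m - (m - 2) = 2" using m_gt by simp
    ultimately have "r dvd 2" by metis
    then show False using kr k_gt by (auto dest: dvd_imp_le)
  qed
  then obtain u w n where uw: "l = u * w * n" "1 \<le> w" "r dvd u + w"
    using prime_dvd_cases[OF \<chi> faithful primes(3) _ rk] v by (metis dvd_triv_right)
  have u: "u \<ge> 1" and n: "n \<ge> 1" using uw(1) l_pos by (cases u; cases n; auto)+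
  have "r \<le> u + w" using uw by (intro dvd_imp_le) auto
  moreover have "u * w * 1 \<le> l" unfolding uw(1) using n by (intro mult_le_mono2)
  moreover have "u + w \<le> u * w + 1"
  proof -
    obtain u' w' where "u = Suc u'" "w = Suc w'" using u uw(2) by (cases u; cases w; auto)
    then show ?thesis by simp
  qed
  ultimately show False using kr l_less by simp
qed

text \<open>\<open>p * r \<le> m\<close> yields \<open>k < q\<close>, and the \<open>p\<close>-th
  power of the faithful character has order \<open>q * r\<close>, as
  \<open>mixed_order_character\<close> demands.\<close>

lemma no_prime_dvd_k_one_two_odd:
  assumes v: "v = p * q * r" and primes: "Factorial_Ring.prime p" "Factorial_Ring.prime q"
    "Factorial_Ring.prime r" "p \<noteq> r" "r \<noteq> 2" and nk: "\<not> q dvd k" "\<not> r dvd k"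
    and m: "q dvd m" "p dvd m - 2" "r dvd m - 2"
  shows False
proof -
  have "coprime p r" using primes by (simp add: primes_coprime)
  then have "p * r dvd m - 2" using m by (simp add: divides_mult)
  then have "p * r \<le> m - 2" using m_gt by (intro dvd_imp_le) auto
  then have "p * r \<le> m" by simp
  then have "p * r * k \<le> m * k" by (rule mult_le_mono1)
  also have "m * k < p * r * q" using mk_less v by (simp add: mult_ac)
  finally have "p * r * k < p * r * q" .
  then have kq: "k < q" by simp
  have gt: "p > 1" "q > 1" "r > 1" using primes prime_gt_1_nat by auto
  show False
  proof (rule mixed_order_character[of q r "\<lambda>x. \<chi> x ^ p"])
    show "character G v (\<lambda>x. \<chi> x ^ p)" by (rule character_power[OF \<chi>])
    have "(\<chi> x ^ p) ^ (q * r) = \<chi> x ^ v" for x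
      by (simp only: v mult.assoc flip: power_mult)
    then show "(\<chi> x ^ p) ^ (q * r) = 1" if "x \<in> carrier G" for x
      using \<chi> that by (simp add: character_def)
    show "\<exists>x\<in>carrier G. (\<chi> x ^ p) ^ q \<noteq> 1"
      using faithful[of "p * q"] gt by (simp add: v power_mult)
    show "\<exists>x\<in>carrier G. (\<chi> x ^ p) ^ r \<noteq> 1"
      using faithful[of "p * r"] gt by (simp add: v power_mult)
  qed (use primes nk m v kq in auto)
qed

text \<open>The situation is symmetric in \<open>p\<close> and \<open>r\<close>, and at most one of
  them is 2; an odd one takes the place of \<open>r\<close>.\<close>

lemma no_prime_dvd_k_one_two:
  assumes v: "v = p * q * r" and primes: "Factorial_Ring.prime p" "Factorial_Ring.prime q"
    "Factorial_Ring.prime r" "p \<noteq> r" and nk: "\<not> p dvd k" "\<not> q dvd k" "\<not> r dvd k"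
    and m: "q dvd m" "p dvd m - 2" "r dvd m - 2"
  shows False
proof (cases "r = 2")
  case False
  then show False using no_prime_dvd_k_one_two_odd[of p q r] assms by blast
next
  case True
  then show False
    using no_prime_dvd_k_one_two_odd[of r q p] assms by (simp add: mult_ac)
qed

text \<open>All three primes dividing the same one of \<open>m\<close> and \<open>m - 2\<close>
  would give \<open>v \<le> m\<close>; what remains is a two-to-one split, up to the permutations in
  \<open>perm\<close>.\<close>

lemma no_prime_dvd_k:
  assumes v: "v = p * q * r" and primes: "Factorial_Ring.prime p" "Factorial_Ring.prime q"
    "Factorial_Ring.prime r" "p \<noteq> q" "p \<noteq> r" "q \<noteq> r"
    and nk: "\<not> p dvd k" "\<not> q dvd k" "\<not> r dvd k"
  shows False
proof -
  have cases: "p dvd m \<or> p dvd m - 2" "q dvd m \<or> q dvd m - 2" "r dvd m \<or> r dvd m - 2"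
    using prime_dvd_m[of p] prime_dvd_m[of q] prime_dvd_m[of r] primes v nk by auto
  have all: "\<not> (p dvd s \<and> q dvd s \<and> r dvd s)" if s: "s = m \<or> s = m - 2" for s
  proof
    assume "p dvd s \<and> q dvd s \<and> r dvd s"
    moreover have "coprime p q" "coprime (p * q) r" using primes by (simp_all add: primes_coprime)
    ultimately have "p * q * r dvd s" by (simp add: divides_mult)
    then have "v \<le> s" using s m_gt v by (auto intro: dvd_imp_le)
    then have "v \<le> m" using s by auto
    moreover have "m * 1 \<le> m * k" using k_gt by (intro mult_le_mono2) simp
    ultimately show False using mk_less by simp
  qed
  have perm: "v = p * r * q" "v = q * r * p" "v = q * p * r" "v = p * q * r" "v = r * q * p" "v = r * p * q"
    using v by (simp_all add: mult_ac)
  show False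
    using cases all[of m] all[of "m - 2"]
      no_prime_dvd_k_two_one[OF perm(4)] no_prime_dvd_k_two_one[OF perm(1)] no_prime_dvd_k_two_one[OF perm(2)]
      no_prime_dvd_k_one_two[OF perm(4)] no_prime_dvd_k_one_two[OF perm(3)] no_prime_dvd_k_one_two[OF perm(1)]
      primes nk by metis
qed

lemma no_sedf:
  assumes v: "v = p * q * r" and primes: "Factorial_Ring.prime p" "Factorial_Ring.prime q"
    "Factorial_Ring.prime r" "p \<noteq> q" "p \<noteq> r" "q \<noteq> r"
  shows False
proof -
  have perm: "v = p * r * q" "v = q * r * p" "v = q * p * r" "v = r * p * q"
    using v by (simp_all add: mult_ac)
  show False
    using two_primes_dvd_k[OF v] two_primes_dvd_k[OF perm(1)] two_primes_dvd_k[OF perm(2)]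
      one_prime_dvd_k[OF v] one_prime_dvd_k[OF perm(3)] one_prime_dvd_k[OF perm(4)]
      no_prime_dvd_k[OF v] primes by metis
qed

end

end

section \<open>Cyclicity of the group and conclusion\<close>

text \<open>The product of elements of the three prime orders generates the group, since coprime
  orders multiply.\<close>

lemma (in comm_group) exists_generator_squarefree:
  assumes fin: "finite (carrier G)" and card: "card (carrier G) = p * q * r"
    and primes: "Factorial_Ring.prime p" "Factorial_Ring.prime q" "Factorial_Ring.prime r"
      "p \<noteq> q" "p \<noteq> r" "q \<noteq> r"
  obtains x where "x \<in> carrier G" "ord x = card (carrier G)"
proof -
  obtain a where a: "a \<in> carrier G" "ord a = p"
    using exists_element_prime_order[OF primes(1) fin] card by auto
  obtain b where b: "b \<in> carrier G" "ord b = q"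
    using exists_element_prime_order[OF primes(2) fin] card by auto
  obtain c where c: "c \<in> carrier G" "ord c = r"
    using exists_element_prime_order[OF primes(3) fin] card by auto
  have "ord (a \<otimes> b) = p * q"
    using ord_mult_coprime[OF a(1) b(1)] a b primes by (simp add: primes_coprime)
  then have "ord (a \<otimes> b \<otimes> c) = p * q * r"
    using ord_mult_coprime[of "a \<otimes> b" c] a b c primes by (simp add: primes_coprime)
  then show thesis using that[of "a \<otimes> b \<otimes> c"] a b c card by simp
qed

theorem theorem29:
  fixes p q r :: nat and G :: "('a, 'b) monoid_scheme"
  assumes "Factorial_Ring.prime p" "Factorial_Ring.prime q" "Factorial_Ring.prime r"
    and "p \<noteq> q" "p \<noteq> r" "q \<noteq> r"
    and "comm_group G" "finite (carrier G)" "card (carrier G) = p * q * r"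
  shows "\<not> (\<exists>m k l D. m > 2 \<and> nontrivial_SEDF G (p * q * r) m k l D)"
proof
  assume "\<exists>m k l D. m > 2 \<and> nontrivial_SEDF G (p * q * r) m k l D"
  then obtain m k l D where "m > 2" "is_SEDF G (p * q * r) m k l D" "k > 1"
    by (auto simp: nontrivial_SEDF_def)
  then interpret sedf G "p * q * r" m k l D by unfold_locales
  obtain x where x: "x \<in> carrier G" "group.ord G x = card (carrier G)"
    using exists_generator_squarefree[OF finite_G card_G assms(1-6)] by blast
  obtain \<chi> where \<chi>: "character G (p * q * r) \<chi>"
    and faithful: "\<And>d. 0 < d \<Longrightarrow> d < p * q * r \<Longrightarrow> \<chi> x ^ d \<noteq> 1"
    using exists_faithful_character[OF x(1) finite_G x(2)] unfolding card_G by blast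
  show False
    by (rule no_sedf[OF \<chi> _ refl assms(1-6)]) (use faithful x(1) in blast)
qed

end
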